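(* Let $f\colon[0,1]\times\mathbb{R}\to\mathbb{R}$ be continuous with $f(t,\mathbb{R}_+)\subset\mathbb{R}_+$ for all $t\in[0,1]$, and assume that $f$ is nondecreasing on $[0,1]\times\mathbb{R}_+$ in each of its two variables. Assume that there exist $R_0,R_1$ with $0<R_0<R_1$ such that $$\int_0^1 M_0(t)\,f\bigl(t,M_0(t)R_0\bigr)\,dt\ge R_0\qquad\text{and}\qquad \int_0^1 M_1(t)\,f\bigl(t,M_1(t)R_1\bigr)\,dt\le R_1 .$$ Let $m=\inf_{u\in K_{R_0R_1}}E(u)$. Then the boundary value problem $$u^{(4)}(t)-f(t,u(t))=0\ \ (0<t<1),\qquad u(0)=u'(0)=u''(1)=u'''(1)=0 \tag{P}$$ has at least one positive solution $u_m\in K_{R_0R_1}$ such that $E(u_m)=m$. If, in addition, there exist $u_0,u_1\in K_{R_0R_1}$ and $r>0$ such that $|u_0|<r<|u_1|$ and $$\max\{E(u_0),E(u_1)\}<\inf\{E(u): u\in K,\ |u|=r\},$$ then (P) has a second positive solution $u_c\in K_{R_0R_1}$ with $E(u_c)=c$, where $$c=\inf_{\gamma\in\Gamma}\max_{t\in[0,1]}E(\gamma(t)),\qquad \Gamma=\{\gamma\in C([0,1];K_{R_0R_1}):\gamma(0)=u_0,\ \gamma(1)=u_1\}.$$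
   Context: $\mathbb{R}_+=[0,\infty)$. $X=\{u\in H^2(0,1): u(0)=u'(0)=0\}$ is the Hilbert space with inner product $(u,v)=\int_0^1u''v''\,dt$ and norm $|u|=\bigl(\int_0^1 u''(t)^2dt\bigr)^{1/2}$. The energy functional $E\colon X\to\mathbb{R}$ is $E(u)=\frac12|u|^2-\int_0^1F(t,u(t))\,dt$, where $F(t,u)=\int_0^uf(t,s)\,ds$. For $t\in[0,1]$, $M_0(t)=\frac{\sqrt2\,(1-t)t^3}{6}$ and $M_1(t)=\frac23t^{3/2}$. The cone is $K=\{u\in X: u\text{ is convex and }u(t)\ge M_0(t)|u|\text{ for all }t\in[0,1]\}$, and the conical shell is $K_{R_0R_1}=\{u\in K: R_0\le|u|\le R_1\}$. Continuity of paths $\gamma$ is with respect to the norm $|\cdot|$ of $X$. A solution of the problem is a classical one ($u\in C^4[0,1]$); it is positive if it is nonnegative on $[0,1]$ and not identically zero. "Second" means distinct from $u_m$. *)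

theory Defs
  imports "HOL-Analysis.Analysis"
begin

text \<open>
  Sobolev spaces on the open interval \<open>(0,1)\<close>, with weak derivatives tested against
  \<open>C\<^sup>1\<close> functions of compact support in \<open>(0,1)\<close>.
\<close>

definition L2 :: "(real \<Rightarrow> real) set" where
  "L2 = {u. u \<in> borel_measurable (lebesgue_on {0<..<1}) \<and>
            integrable (lebesgue_on {0<..<1}) (\<lambda>t. (u t)\<^sup>2)}"

definition test_funs :: "(real \<Rightarrow> real) set" where
  "test_funs = {\<phi>. \<phi> C1_differentiable_on UNIV \<and>
                   (\<exists>C. compact C \<and> C \<subseteq> {0<..<1} \<and> (\<forall>t. t \<notin> C \<longrightarrow> \<phi> t = 0))}"

definition is_weak_deriv :: "(real \<Rightarrow> real) \<Rightarrow> (real \<Rightarrow> real) \<Rightarrow> bool" where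
  "is_weak_deriv u v \<longleftrightarrow>
     (\<forall>\<phi>\<in>test_funs. (LINT t|lebesgue_on {0<..<1}. u t * deriv \<phi> t)
                    = - (LINT t|lebesgue_on {0<..<1}. v t * \<phi> t))"

definition H1 :: "(real \<Rightarrow> real) set" where
  "H1 = {u \<in> L2. \<exists>v\<in>L2. is_weak_deriv u v}"

text \<open>The weak derivative is determined only almost everywhere; a representative is chosen.\<close>

definition wderiv :: "(real \<Rightarrow> real) \<Rightarrow> real \<Rightarrow> real" where
  "wderiv u = (SOME v. v \<in> L2 \<and> is_weak_deriv u v)"

definition H2 :: "(real \<Rightarrow> real) set" where
  "H2 = {u \<in> H1. wderiv u \<in> H1}"

text \<open>
  An element of \<open>X\<close> is represented by its continuous representative on \<open>[0,1]\<close> (which is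
  automatically \<open>C\<^sup>1\<close> there), extended by \<open>0\<close> outside \<open>[0,1]\<close>. The representation is unique,
  so equality in \<open>X\<close> is equality of functions.
\<close>

definition X :: "(real \<Rightarrow> real) set" where
  "X = {u \<in> H2. continuous_on {0..1} u \<and> (\<forall>t. t \<notin> {0..1} \<longrightarrow> u t = 0) \<and>
                u 0 = 0 \<and> (u has_real_derivative 0) (at 0 within {0..1})}"

definition normX :: "(real \<Rightarrow> real) \<Rightarrow> real" where
  "normX u = sqrt (LINT t|lebesgue_on {0<..<1}. (wderiv (wderiv u) t)\<^sup>2)"

definition F :: "(real \<Rightarrow> real \<Rightarrow> real) \<Rightarrow> real \<Rightarrow> real \<Rightarrow> real" where
  "F f t u = (LBINT s=ereal 0..ereal u. f t s)"

definition energy :: "(real \<Rightarrow> real \<Rightarrow> real) \<Rightarrow> (real \<Rightarrow> real) \<Rightarrow> real" where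
  "energy f u = 1/2 * (normX u)\<^sup>2 - (LBINT t=ereal 0..ereal 1. F f t (u t))"

definition M0 :: "real \<Rightarrow> real" where
  "M0 t = sqrt 2 * (1 - t) * t ^ 3 / 6"

definition M1 :: "real \<Rightarrow> real" where
  "M1 t = 2/3 * t powr (3/2)"

definition K_cone :: "(real \<Rightarrow> real) set" where
  "K_cone = {u \<in> X. convex_on {0..1} u \<and> (\<forall>t\<in>{0..1}. u t \<ge> M0 t * normX u)}"

definition shell :: "real \<Rightarrow> real \<Rightarrow> (real \<Rightarrow> real) set" where
  "shell R0 R1 = {u \<in> K_cone. R0 \<le> normX u \<and> normX u \<le> R1}"

definition solution :: "(real \<Rightarrow> real \<Rightarrow> real) \<Rightarrow> (real \<Rightarrow> real) \<Rightarrow> bool" where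
  "solution f u \<longleftrightarrow>
     (\<exists>u1 u2 u3 u4.
        (\<forall>t\<in>{0..1}. (u has_real_derivative u1 t) (at t within {0..1}) \<and>
                    (u1 has_real_derivative u2 t) (at t within {0..1}) \<and>
                    (u2 has_real_derivative u3 t) (at t within {0..1}) \<and>
                    (u3 has_real_derivative u4 t) (at t within {0..1})) \<and>
        continuous_on {0..1} u4 \<and>
        (\<forall>t\<in>{0<..<1}. u4 t - f t (u t) = 0) \<and>
        u 0 = 0 \<and> u1 0 = 0 \<and> u2 1 = 0 \<and> u3 1 = 0)"

definition positive_solution :: "(real \<Rightarrow> real \<Rightarrow> real) \<Rightarrow> (real \<Rightarrow> real) \<Rightarrow> bool" where
  "positive_solution f u \<longleftrightarrow>
     solution f u \<and> (\<forall>t\<in>{0..1}. u t \<ge> 0) \<and> (\<exists>t\<in>{0..1}. u t \<noteq> 0)"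

text \<open>
  Paths are continuous for \<^term>\<open>normX\<close>; values of \<open>\<gamma>\<close> outside \<open>[0,1]\<close> are irrelevant.
\<close>

definition paths ::
  "real \<Rightarrow> real \<Rightarrow> (real \<Rightarrow> real) \<Rightarrow> (real \<Rightarrow> real) \<Rightarrow> (real \<Rightarrow> real \<Rightarrow> real) set" where
  "paths R0 R1 u0 u1 =
     {\<gamma>. (\<forall>t\<in>{0..1}. \<gamma> t \<in> shell R0 R1) \<and>
         (\<forall>t\<in>{0..1}. ((\<lambda>s. normX (\<lambda>x. \<gamma> s x - \<gamma> t x)) \<longlongrightarrow> 0) (at t within {0..1})) \<and>
         \<gamma> 0 = u0 \<and> \<gamma> 1 = u1}"

text \<open>
  Extrema of the energy are taken in the extended reals, so that they are meaningful without a
  boundedness or nonemptiness proof. The maximum along a path is written as a supremum: the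
  energy is continuous along \<open>\<gamma>\<close> and \<open>[0,1]\<close> is compact, so it is attained.
\<close>

definition inf_energy :: "(real \<Rightarrow> real \<Rightarrow> real) \<Rightarrow> (real \<Rightarrow> real) set \<Rightarrow> ereal" where
  "inf_energy f A = (INF u\<in>A. ereal (energy f u))"

definition minimax_level ::
  "(real \<Rightarrow> real \<Rightarrow> real) \<Rightarrow> real \<Rightarrow> real \<Rightarrow> (real \<Rightarrow> real) \<Rightarrow> (real \<Rightarrow> real) \<Rightarrow> ereal" where
  "minimax_level f R0 R1 u0 u1 =
     (INF \<gamma>\<in>paths R0 R1 u0 u1. SUP t\<in>{0..1}. ereal (energy f (\<gamma> t)))"

end

theory Submission
  imports Defs "HOL-Complex_Analysis.Great_Picard"
begin

text \<open>
  Let \<open>N u\<close> be the function with fourth derivative \<open>f(t,u)\<close> that satisfies the boundary conditions of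
  the problem, so that \<open>E'(u) = u - N u\<close>. A Harnack inequality for \<open>N\<close> shows \<open>N(K) \<subseteq> K\<close>. Since \<open>f\<close> is
  nondecreasing in its second variable, the two integral conditions give \<open>(N u, v) \<ge> R\<^sub>0|v|\<close> for
  \<open>|u| \<ge> R\<^sub>0\<close> and \<open>(N u, v) \<le> R\<^sub>1|v|\<close> for \<open>|u| \<le> R\<^sub>1\<close>, whenever \<open>u, v \<in> K\<close>. Hence \<open>N\<close>, and every map
  \<open>u \<mapsto> u + h(N u - u)\<close> with \<open>0 \<le> h \<le> 1\<close>, sends the shell into itself. Moreover \<open>F(t,\<cdot>)\<close> is convex on
  \<open>[0,\<infinity>)\<close>, which yields the descent estimate
  \<open>E(u + h(N u - u)) \<le> E(u) - (h - h\<^sup>2/2)|u - N u|\<^sup>2\<close>. Minimising sequences therefore satisfy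
  \<open>u\<^sub>n - N u\<^sub>n \<rightarrow> 0\<close>, and the same maps deform paths without leaving the shell, which produces such
  sequences at the level \<open>c\<close>. Since \<open>N\<close> is continuous from \<open>C[0,1]\<close> to \<open>X\<close>, the theorem of Arzela and
  Ascoli turns them into fixed points of \<open>N\<close>, which are classical solutions.
\<close>

section \<open>Primitives on the unit interval\<close>

text \<open>Weak derivatives are fixed only up to null sets and \<open>wderiv\<close> selects them
  by choice, so little about \<open>X\<close> can be computed from its definition. Everything passes
  through the bijection that sends u to its second derivative, from \<open>X\<close> onto the square
  integrable functions modulo null sets. Its inverse is the double primitive from 0, and the du
  Bois-Reymond lemma is what makes the correspondence exact. The second obstacle is the inner
  sphere: the shell is not convex, so a deformation that lowers the energy could leave it towards
  the origin. Steps along the segment from u to N u stay inside, because pairing the new point with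
  u itself keeps its norm at least R0. These steps use only the tangent inequality of the convex
  function F(t, .), so the energy is compared between points and never differentiated. The weight M1
  arises by integrating the bound |u'(t)| \<le> sqrt t |u|; the weight M0 lies below the polynomial
  t^2/2 - t^3/3 + t^4/12 that the Harnack argument produces.\<close>

abbreviation U01 :: "real measure" where
  "U01 \<equiv> lebesgue_on {0<..<1}"

lemma space_U01 [simp]: "space U01 = {0<..<1}"
  by (simp add: space_restrict_space)

lemma finite_measure_U01: "finite_measure U01"
  by (rule finite_measure_lebesgue_on) simp

interpretation U01: finite_measure U01
  by (rule finite_measure_U01)

lemma borel_measurable_U01 [measurable (raw)]:
  "f \<in> borel_measurable borel \<Longrightarrow> f \<in> borel_measurable U01"
  by (intro measurable_restrict_space1 measurable_completion) simp

lemma measurable_U01_cont: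
  fixes f :: "real \<Rightarrow> real"
  assumes "continuous_on {0..1} f"
  shows "f \<in> borel_measurable U01"
  by (intro continuous_imp_measurable_on_sets_lebesgue continuous_on_subset[OF assms]) auto

lemma continuous_bounded_01:
  fixes f :: "real \<Rightarrow> real"
  assumes "continuous_on {0..1} f"
  obtains B where "B > 0" "\<And>t. t \<in> {0..1} \<Longrightarrow> \<bar>f t\<bar> \<le> B"
proof -
  have "compact (f ` {0..1})"
    by (intro compact_continuous_image assms) auto
  then obtain B where "B > 0" "\<forall>x\<in>f ` {0..1}. norm x \<le> B"
    using compact_imp_bounded bounded_pos by blast
  then show ?thesis using that by auto
qed

lemma integrable_U01_mult_bounded:
  fixes f h :: "real \<Rightarrow> real"
  assumes "integrable U01 h" "f \<in> borel_measurable U01" "\<And>t. t \<in> {0<..<1} \<Longrightarrow> \<bar>f t\<bar> \<le> B"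
  shows "integrable U01 (\<lambda>t. f t * h t)"
proof (rule Bochner_Integration.integrable_bound)
  show "integrable U01 (\<lambda>t. B * h t)" using assms(1) by simp
  show "(\<lambda>t. f t * h t) \<in> borel_measurable U01" using assms(1,2) by simp
  have "0 \<le> B" using assms(3)[of "1/2"] by auto
  then show "AE t in U01. norm (f t * h t) \<le> norm (B * h t)"
    by (intro AE_I2) (auto simp: abs_mult intro!: mult_mono assms(3))
qed

lemma integrable_U01_mult_cont:
  fixes f h :: "real \<Rightarrow> real"
  assumes "integrable U01 h" "continuous_on {0..1} f"
  shows "integrable U01 (\<lambda>t. f t * h t)"
  using continuous_bounded_01[OF assms(2)] measurable_U01_cont[OF assms(2)]
  by (metis assms(1) atLeastAtMost_iff greaterThanLessThan_iff integrable_U01_mult_bounded less_eq_real_def)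

lemma integrable_U01_cont:
  fixes f :: "real \<Rightarrow> real"
  assumes "continuous_on {0..1} f"
  shows "integrable U01 f"
  using integrable_U01_mult_cont[OF _ assms, of "\<lambda>_. 1"] by simp

lemma integral_U01_eq:
  fixes f :: "real \<Rightarrow> real"
  assumes "integrable U01 f"
  shows "integral\<^sup>L U01 f = integral {0..1} f"
  using lebesgue_integral_eq_integral[OF assms] by (simp add: integral_open_interval_real)

lemma LBINT_eq_integral:
  fixes f :: "real \<Rightarrow> real"
  assumes "continuous_on {a..b} f" "a \<le> b"
  shows "(LBINT t=ereal a..ereal b. f t) = integral {a..b} f"
  by (intro interval_integral_eq_integral borel_integrable_atLeastAtMost' assms)

text \<open>With the indicator inside the integral, \<open>prim h\<close> is defined on the whole
  line: it is 0 left of 0 and constant right of 1. The same form is suited to Fubini and exhibits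
  \<open>prim h t\<close> as a pairing of h with an indicator.\<close>

definition prim :: "(real \<Rightarrow> real) \<Rightarrow> real \<Rightarrow> real" where
  "prim h t = (LINT s|U01. indicator {..t} s * h s)"

lemma prim_0 [simp]: "prim h 0 = 0"
proof -
  have "prim h 0 = (LINT s|U01. 0)"
    unfolding prim_def by (rule Bochner_Integration.integral_cong) (auto simp: indicator_def)
  then show ?thesis by simp
qed

lemma prim_1: "prim h 1 = integral\<^sup>L U01 h"
  unfolding prim_def by (rule Bochner_Integration.integral_cong) (auto simp: indicator_def)

lemma integrable_indicator_mult:
  assumes "integrable U01 h"
  shows "integrable U01 (\<lambda>s. indicator {..t} s * (h s::real))"
  by (rule integrable_U01_mult_bounded[OF assms, of _ 1]) (auto simp: indicator_def)

lemma prim_add: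
  assumes "integrable U01 g" "integrable U01 h"
  shows "prim (\<lambda>s. a * g s + b * h s) t = a * prim g t + b * prim h t"
proof -
  have "prim (\<lambda>s. a * g s + b * h s) t =
      (LINT s|U01. a * (indicator {..t} s * g s) + b * (indicator {..t} s * h s))"
    unfolding prim_def by (simp add: algebra_simps)
  also have "\<dots> = a * prim g t + b * prim h t"
    unfolding prim_def
    by (subst Bochner_Integration.integral_add)
       (auto intro!: integrable_mult_right integrable_indicator_mult assms)
  finally show ?thesis .
qed

lemma prim_cong_AE:
  assumes "AE t in U01. g t = h t" "g \<in> borel_measurable U01" "h \<in> borel_measurable U01"
  shows "prim g t = prim h t"
  unfolding prim_def
proof (rule integral_cong_AE)
  show "AE s in U01. indicat_real {..t} s * g s = indicat_real {..t} s * h s"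
    using assms(1) by eventually_elim simp
qed (use assms(2,3) in measurable)

lemma prim_eq_integral:
  assumes "integrable U01 h" "t \<in> {0..1}"
  shows "prim h t = integral {0..t} h"
proof -
  have "prim h t = integral {0..1} (\<lambda>s. indicator {..t} s * h s)"
    unfolding prim_def by (intro integral_U01_eq integrable_indicator_mult assms)
  also have "\<dots> = integral {0..1} (\<lambda>s. if s \<in> {..t} then h s else 0)"
    by (rule arg_cong[of _ _ "integral _"]) (auto simp: indicator_def)
  also have "\<dots> = integral ({..t} \<inter> {0..1}) h"
    by (rule integral_restrict_Int)
  also have "{..t} \<inter> {0..1} = {0..t}" using assms(2) by auto
  finally show ?thesis .
qed

lemma integrable_on_01:
  fixes h :: "real \<Rightarrow> real"
  assumes "integrable U01 h"
  shows "h integrable_on {0..1}"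
  using has_integral_integral_lebesgue_on[OF assms]
  by (auto simp flip: has_integral_Icc_iff_Ioo)

lemma continuous_on_prim:
  assumes "integrable U01 h"
  shows "continuous_on {0..1} (prim h)"
proof -
  have "continuous_on {0..1} (\<lambda>t. integral {0..t} h)"
    by (rule indefinite_integral_continuous_1 [OF integrable_on_01[OF assms]])
  then show ?thesis
    by (rule continuous_on_eq) (simp add: prim_eq_integral assms)
qed

lemma prim_deriv:
  assumes "continuous_on {0..1} h" "t \<in> {0..1}"
  shows "(prim h has_real_derivative h t) (at t within {0..1})"
proof -
  have "((\<lambda>t. integral {0..t} h) has_real_derivative h t) (at t within {0..1})"
    by (rule integral_has_real_derivative[OF assms])
  then show ?thesis
    by (rule has_field_derivative_transform_within[OF _ zero_less_one])
      (use assms in \<open>auto simp: prim_eq_integral integrable_U01_cont\<close>)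
qed

lemma integral_deriv_eq:
  fixes \<phi> :: "real \<Rightarrow> real"
  assumes "\<And>t. t \<in> {0..1} \<Longrightarrow> (\<phi> has_real_derivative \<phi>' t) (at t within {0..1})"
    and "continuous_on {0..1} \<phi>'" "s \<in> {0..1}"
  shows "(LINT t|U01. indicator {s..} t * \<phi>' t) = \<phi> 1 - \<phi> s"
proof -
  have int: "integrable U01 (\<lambda>t. indicator {s..} t * \<phi>' t)"
    by (rule integrable_U01_mult_bounded[OF integrable_U01_cont[OF assms(2)], of _ 1]) (auto simp: indicator_def)
  have "(LINT t|U01. indicator {s..} t * \<phi>' t) = integral {0..1} (\<lambda>t. if t \<in> {s..} then \<phi>' t else 0)"
    unfolding integral_U01_eq[OF int]
    by (rule arg_cong[of _ _ "integral _"]) (auto simp: indicator_def)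
  also have "\<dots> = integral ({s..} \<inter> {0..1}) \<phi>'"
    by (rule integral_restrict_Int)
  also have "{s..} \<inter> {0..1} = {s..1}" using assms(3) by auto
  also have "integral {s..1} \<phi>' = \<phi> 1 - \<phi> s"
  proof (rule integral_unique, rule fundamental_theorem_of_calculus)
    show "s \<le> 1" using assms(3) by simp
    fix x assume x: "x \<in> {s..1}"
    have "(\<phi> has_real_derivative \<phi>' x) (at x within {s..1})"
      by (rule DERIV_subset[OF assms(1)]) (use x assms(3) in auto)
    then show "(\<phi> has_vector_derivative \<phi>' x) (at x within {s..1})"
      by (simp add: has_real_derivative_iff_has_vector_derivative)
  qed
  finally show ?thesis .
qed

text \<open>As h is merely integrable, \<open>prim h\<close> need not be differentiable everywhere,
  and the classical product rule does not apply. Instead the left side is an iterated integral of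
  \<open>\<phi>' t * h s\<close> over the triangle s \<le> t; after exchanging the order, the inner
  integral over [s,1] is \<open>\<phi> 1 - \<phi> s\<close>.\<close>

lemma integral_by_parts_prim:
  fixes \<phi> :: "real \<Rightarrow> real"
  assumes h: "integrable U01 h"
    and \<phi>: "\<And>t. t \<in> {0..1} \<Longrightarrow> (\<phi> has_real_derivative \<phi>' t) (at t within {0..1})"
    and \<phi>': "continuous_on {0..1} \<phi>'"
  shows "(LINT t|U01. \<phi>' t * prim h t) = \<phi> 1 * integral\<^sup>L U01 h - (LINT t|U01. \<phi> t * h t)"
proof -
  interpret P: pair_sigma_finite U01 U01 ..
  define k where "k = (\<lambda>t s. indicator {..t} s * \<phi>' t * h s)"
  have h_meas [measurable]: "h \<in> borel_measurable U01" using h by simp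
  have \<phi>'_meas [measurable]: "\<phi>' \<in> borel_measurable U01" by (rule measurable_U01_cont[OF \<phi>'])
  obtain B where B: "B > 0" "\<And>t. t \<in> {0..1} \<Longrightarrow> \<bar>\<phi>' t\<bar> \<le> B"
    using continuous_bounded_01[OF \<phi>'] by blast
  have id_meas [measurable]: "(\<lambda>x. x) \<in> borel_measurable U01"
    by (rule borel_measurable_U01) simp
  \<comment> \<open>Writing the indicator as a comparison of coordinates reduces joint measurability
    to that of the two projections.\<close>
  have k_alt: "case_prod k = (\<lambda>p. (if snd p \<le> fst p then 1 else 0) * \<phi>' (fst p) * h (snd p))"
    by (auto simp: k_def fun_eq_iff indicator_def)
  have k_meas: "case_prod k \<in> borel_measurable (U01 \<Otimes>\<^sub>M U01)"
  proof -
    have [measurable]: "fst \<in> borel_measurable (U01 \<Otimes>\<^sub>M U01)" "snd \<in> borel_measurable (U01 \<Otimes>\<^sub>M U01)"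
      using measurable_compose[OF measurable_fst id_meas] measurable_compose[OF measurable_snd id_meas] by auto
    show ?thesis unfolding k_alt by measurable
  qed
  have kt: "integrable U01 (k t)" for t
    using integrable_indicator_mult[OF h, of t] unfolding k_def by (simp add: mult.assoc mult.left_commute)
  have "integrable (U01 \<Otimes>\<^sub>M U01) (case_prod k)"
  proof (rule P.Fubini_integrable[OF k_meas])
    show "integrable U01 (\<lambda>x. LINT y|U01. norm (case (x, y) of (x, y) \<Rightarrow> k x y))"
    proof (rule U01.integrable_const_bound[of _ "B * (LINT s|U01. \<bar>h s\<bar>)"])
      show "AE t in U01. norm (LINT y|U01. norm (case (t, y) of (x, y) \<Rightarrow> k x y)) \<le> B * (LINT s|U01. \<bar>h s\<bar>)"
      proof (rule AE_I2)
        fix t :: real assume "t \<in> space U01"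
        then have t: "t \<in> {0..1}" by auto
        have "(LINT y|U01. \<bar>k t y\<bar>) \<le> (LINT y|U01. B * \<bar>h y\<bar>)"
        proof (rule integral_mono)
          show "\<bar>k t s\<bar> \<le> B * \<bar>h s\<bar>" for s
            using B(2)[OF t] B(1) by (auto simp: k_def abs_mult indicator_def intro!: mult_right_mono)
        qed (use kt h in auto)
        then show "norm (LINT y|U01. norm (case (t, y) of (x, y) \<Rightarrow> k x y)) \<le> B * (LINT s|U01. \<bar>h s\<bar>)"
          by simp
      qed
      show "(\<lambda>x. LINT y|U01. norm (case (x, y) of (x, y) \<Rightarrow> k x y)) \<in> borel_measurable U01"
        using U01.borel_measurable_lebesgue_integral[of "\<lambda>x y. norm (k x y)" U01] k_meas
        by (simp add: case_prod_unfold)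
    qed
    show "AE x in U01. integrable U01 (\<lambda>y. case (x, y) of (x, y) \<Rightarrow> k x y)"
      using kt by simp
  qed
  note Fub = P.Fubini_integral[OF this]
  have "(LINT t|U01. \<phi>' t * prim h t) = (LINT t|U01. LINT s|U01. k t s)"
    unfolding prim_def k_def by (simp flip: integral_mult_right_zero add: mult_ac)
  also have "\<dots> = (LINT s|U01. LINT t|U01. k t s)"
    using Fub by simp
  also have "\<dots> = (LINT s|U01. \<phi> 1 * h s - \<phi> s * h s)"
  proof (rule Bochner_Integration.integral_cong[OF refl])
    fix s :: real assume "s \<in> space U01"
    then have s: "s \<in> {0..1}" by auto
    have "(LINT t|U01. k t s) = (LINT t|U01. h s * (indicator {s..} t * \<phi>' t))"
      unfolding k_def by (rule Bochner_Integration.integral_cong) (auto simp: indicator_def)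
    also have "\<dots> = h s * (\<phi> 1 - \<phi> s)"
      using integral_deriv_eq[OF \<phi> \<phi>' s] by simp
    finally show "(LINT t|U01. k t s) = \<phi> 1 * h s - \<phi> s * h s" by (simp add: algebra_simps)
  qed
  also have "\<dots> = \<phi> 1 * integral\<^sup>L U01 h - (LINT t|U01. \<phi> t * h t)"
  proof -
    have "continuous_on {0..1} \<phi>"
      by (rule DERIV_continuous_on[OF \<phi>])
    then show ?thesis
      by (subst Bochner_Integration.integral_diff)
        (use h in \<open>auto intro!: integrable_U01_mult_cont\<close>)
  qed
  finally show ?thesis .
qed

section \<open>Weak derivatives\<close>

lemma AE_U01_negligible:
  assumes "negligible N"
  shows "AE t in U01. t \<notin> N"
proof -
  have "N \<in> null_sets lebesgue"
    using assms by (simp add: negligible_iff_null_sets)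
  then have "AE t in lebesgue. t \<notin> N" by (rule AE_not_in)
  then show ?thesis
    by (subst AE_restrict_space_iff) auto
qed

text \<open>Tests against polynomials approximating the bounded function \<open>w / (1 + \<bar>w\<bar>)\<close>.\<close>

lemma AE_zero_if_orthogonal_polynomials:
  fixes w :: "real \<Rightarrow> real"
  assumes w: "integrable U01 w"
    and orth: "\<And>p. real_polynomial_function p \<Longrightarrow> (LINT t|U01. p t * w t) = 0"
  shows "AE t in U01. w t = 0"
proof -
  have w_meas [measurable]: "w \<in> borel_measurable U01" using w by simp
  define s where "s = (\<lambda>t. w t / (1 + \<bar>w t\<bar>))"
  have s_meas [measurable]: "s \<in> borel_measurable U01" unfolding s_def by measurable
  have s_le: "\<bar>s t\<bar> \<le> 1" for t
    by (simp add: s_def abs_divide divide_le_eq)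
  \<comment> \<open>\<open>measurable_on\<close> supplies continuous functions converging to s off a
    negligible set.\<close>
  have "s measurable_on {0<..<1}"
    using s_meas by (subst measurable_on_iff_borel_measurable) auto
  then obtain N g where N: "negligible N" and g: "\<And>n. continuous_on UNIV (g n)"
    and lim: "\<And>x. x \<notin> N \<Longrightarrow> (\<lambda>n. g n x) \<longlonglongrightarrow> (if x \<in> {0<..<1} then s x else 0)"
    unfolding measurable_on_def by blast
  \<comment> \<open>Clamping to [-1,1] does not change the limit, since |s| \<le> 1, and gives the
    uniform bound needed for dominated convergence.\<close>
  define c where "c = (\<lambda>n::nat. \<lambda>t. max (-1) (min 1 (g n t)))"
  have "\<exists>p. real_polynomial_function p \<and> (\<forall>x\<in>{0..1}. \<bar>c n x - p x\<bar> < inverse (real (Suc n)))" for n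
  proof -
    have "continuous_on {0..1} (c n)"
      unfolding c_def by (intro continuous_intros continuous_on_subset[OF g]) auto
    then obtain p where "real_polynomial_function p" "\<And>x. x \<in> {0..1} \<Longrightarrow> \<bar>c n x - p x\<bar> < inverse (real (Suc n))"
      using Stone_Weierstrass_real_polynomial_function[of "{0..1::real}" "c n" "inverse (real (Suc n))"]
      by (metis compact_Icc inverse_positive_iff_positive of_nat_0_less_iff zero_less_Suc)
    then show ?thesis by blast
  qed
  then obtain p where p: "\<And>n. real_polynomial_function (p n)"
    and pc: "\<And>n x. x \<in> {0..1} \<Longrightarrow> \<bar>c n x - p n x\<bar> < inverse (real (Suc n))"
    by metis
  have p_le: "\<bar>p n x\<bar> \<le> 2" if "x \<in> {0..1}" for n x
  proof -
    have "\<bar>c n x\<bar> \<le> 1" by (auto simp: c_def)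
    moreover have "inverse (real (Suc n)) \<le> 1" by (simp add: inverse_le_1_iff)
    ultimately show ?thesis using pc[OF that, of n] by linarith
  qed
  have p_meas [measurable]: "p n \<in> borel_measurable U01" for n
    using p[of n]
    by (intro measurable_U01_cont continuous_on_polymonial_function) (simp add: real_polynomial_function_eq)
  have "(\<lambda>n. LINT t|U01. p n t * w t) \<longlonglongrightarrow> (LINT t|U01. s t * w t)"
  proof (rule integral_dominated_convergence)
    show "integrable U01 (\<lambda>t. 2 * \<bar>w t\<bar>)" using w by simp
    show "AE t in U01. (\<lambda>n. p n t * w t) \<longlonglongrightarrow> s t * w t"
      using AE_U01_negligible[OF N] AE_space
    proof eventually_elim
      case (elim t)
      then have t: "t \<in> {0..1}" "t \<in> {0<..<1}" by auto
      have "(\<lambda>n. g n t) \<longlonglongrightarrow> s t" using lim[OF elim(1)] t(2) by simp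
      then have "(\<lambda>n. c n t) \<longlonglongrightarrow> max (-1) (min 1 (s t))"
        unfolding c_def by (intro tendsto_intros)
      moreover have "max (-1) (min 1 (s t)) = s t" using s_le[of t] by auto
      ultimately have c: "(\<lambda>n. c n t) \<longlonglongrightarrow> s t" by simp
      have "(\<lambda>n. c n t - p n t) \<longlonglongrightarrow> 0"
      proof (rule Lim_null_comparison[OF _ LIMSEQ_inverse_real_of_nat], intro always_eventually allI)
        show "norm (c n t - p n t) \<le> inverse (real (Suc n))" for n
          using pc[OF t(1), of n] by simp
      qed
      from tendsto_diff[OF c this] have "(\<lambda>n. p n t) \<longlonglongrightarrow> s t" by simp
      then show ?case by (intro tendsto_intros)
    qed
    show "AE t in U01. norm (p n t * w t) \<le> 2 * \<bar>w t\<bar>" for n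
      by (intro AE_I2) (auto simp: abs_mult intro!: mult_right_mono p_le)
  qed measurable
  then have zero: "(LINT t|U01. s t * w t) = 0"
    using orth[OF p] by (simp add: LIMSEQ_const_iff)
  have "integrable U01 (\<lambda>t. s t * w t)"
    by (rule integrable_U01_mult_bounded[OF w s_meas, of 1]) (rule s_le)
  \<comment> \<open>The product is w^2 / (1 + |w|), so a zero integral forces w = 0 almost
    everywhere.\<close>
  moreover have "0 \<le> s t * w t" for t
    by (simp add: s_def)
  ultimately have "AE t in U01. s t * w t = 0"
    using zero by (subst (asm) integral_nonneg_eq_0_iff_AE) auto
  then show ?thesis
    by eventually_elim (auto simp: s_def)
qed

text \<open>The derivative of a polynomial is again a polynomial, so integration by parts expresses
  the integral of p w through \<open>prim w\<close> and its value at 1, both of which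
  vanish.\<close>

lemma AE_zero_if_prim_zero:
  assumes w: "integrable U01 w" and "\<And>t. t \<in> {0..1} \<Longrightarrow> prim w t = 0"
  shows "AE t in U01. w t = 0"
proof (rule AE_zero_if_orthogonal_polynomials[OF w])
  fix p :: "real \<Rightarrow> real" assume "real_polynomial_function p"
  then obtain p' where p': "real_polynomial_function p'"
    and p: "\<And>x. (p has_real_derivative p' x) (at x)"
    using has_real_derivative_polynomial_function by blast
  have "(LINT t|U01. p' t * prim w t) = p 1 * integral\<^sup>L U01 w - (LINT t|U01. p t * w t)"
  proof (rule integral_by_parts_prim[OF w])
    show "continuous_on {0..1} p'"
      using p' by (simp add: continuous_on_polymonial_function real_polynomial_function_eq)
  qed (use p in \<open>auto intro: has_field_derivative_at_within\<close>)
  moreover have "(LINT t|U01. p' t * prim w t) = (LINT t|U01. 0)"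
    using assms(2) by (intro Bochner_Integration.integral_cong) auto
  moreover have "integral\<^sup>L U01 w = 0" using assms(2)[of 1] by (simp add: prim_1)
  ultimately show "(LINT t|U01. p t * w t) = 0" by simp
qed

lemma continuous_AE_const:
  fixes f :: "real \<Rightarrow> real"
  assumes f: "continuous_on {0..1} f" and "AE t in U01. f t = k" and t: "t \<in> {0..1}"
  shows "f t = k"
proof -
  have c: "continuous_on {0..1} (\<lambda>t. \<bar>f t - k\<bar>)" by (intro continuous_intros f)
  have "integral {0..1} (\<lambda>t. \<bar>f t - k\<bar>) = (LINT t|U01. \<bar>f t - k\<bar>)"
    using integral_U01_eq[OF integrable_U01_cont[OF c]] by simp
  also have "\<dots> = 0" by (rule integral_eq_zero_AE) (use assms(2) in auto)
  finally show ?thesis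
    using integral_eq_0_iff[OF c] t by auto
qed

section \<open>Test functions and the du Bois-Reymond lemma\<close>

lemma test_funsD:
  assumes "\<phi> \<in> test_funs"
  shows "(\<phi> has_real_derivative deriv \<phi> t) (at t within S)" "continuous_on S (deriv \<phi>)"
    "\<phi> 1 = 0"
proof -
  obtain D where D: "\<And>x. (\<phi> has_vector_derivative D x) (at x)" "continuous_on UNIV D"
    using assms by (auto simp: test_funs_def C1_differentiable_on_def)
  have D': "(\<phi> has_real_derivative D x) (at x)" for x
    using D(1) by (simp add: has_real_derivative_iff_has_vector_derivative)
  have "deriv \<phi> = D"
    using DERIV_imp_deriv[OF D'] by auto
  then show "(\<phi> has_real_derivative deriv \<phi> t) (at t within S)" "continuous_on S (deriv \<phi>)"
    using D' D(2) by (auto intro: has_field_derivative_at_within continuous_on_subset)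
  show "\<phi> 1 = 0" using assms by (force simp: test_funs_def)
qed

text \<open>This is the source of test functions: vanishing near 0 makes the primitive vanish there,
  and mean zero makes it vanish near 1 as well.\<close>

lemma test_funs_prim:
  fixes \<psi> :: "real \<Rightarrow> real"
  assumes cont: "continuous_on UNIV \<psi>" and d: "d > 0"
    and zero: "\<And>t. t \<le> d \<or> t \<ge> 1 - d \<Longrightarrow> \<psi> t = 0"
    and int: "integral\<^sup>L U01 \<psi> = 0"
  shows "prim \<psi> \<in> test_funs" "deriv (prim \<psi>) = \<psi>"
proof -
  have left: "prim \<psi> t = 0" if "t \<le> d" for t
  proof -
    have "prim \<psi> t = (LINT s|U01. 0)"
      unfolding prim_def by (rule Bochner_Integration.integral_cong)
        (use that zero in \<open>auto simp: indicator_def\<close>)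
    then show ?thesis by simp
  qed
  have right: "prim \<psi> t = 0" if "t \<ge> 1 - d" for t
  proof -
    have "prim \<psi> t = integral\<^sup>L U01 \<psi>"
      unfolding prim_def by (rule Bochner_Integration.integral_cong)
        (use that zero in \<open>auto simp: indicator_def\<close>)
    then show ?thesis using int by simp
  qed
  have der: "(prim \<psi> has_real_derivative \<psi> t) (at t)" for t
  proof -
    \<comment> \<open>The primitive is known to be differentiable only within [0,1]; since d > 0,
      the two outer cases cover the endpoints and everything beyond.\<close>
    consider "t < d" | "t > 1 - d" | "t \<in> {0<..<1}" using d by force
    then show ?thesis
    proof cases
      case 1
      have "((\<lambda>_. 0) has_real_derivative 0) (at t)" by simp
      then have "(prim \<psi> has_real_derivative 0) (at t)"
        by (rule has_field_derivative_transform_within_open[of _ _ _ "{..<d}"]) (use 1 left in auto)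
      then show ?thesis using zero[of t] 1 by simp
    next
      case 2
      have "((\<lambda>_. 0) has_real_derivative 0) (at t)" by simp
      then have "(prim \<psi> has_real_derivative 0) (at t)"
        by (rule has_field_derivative_transform_within_open[of _ _ _ "{1-d<..}"]) (use 2 right in auto)
      then show ?thesis using zero[of t] 2 by simp
    next
      case 3
      then have "(prim \<psi> has_real_derivative \<psi> t) (at t within {0..1})"
        by (intro prim_deriv continuous_on_subset[OF cont]) auto
      then show ?thesis using 3 by (simp add: at_within_Icc_at)
    qed
  qed
  show "deriv (prim \<psi>) = \<psi>" using DERIV_imp_deriv[OF der] by auto
  have "prim \<psi> C1_differentiable_on UNIV"
    using der cont by (auto simp: C1_differentiable_on_def has_real_derivative_iff_has_vector_derivative)
  moreover have "{d..1-d} \<subseteq> {0<..<1}" using d by auto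
  moreover have "prim \<psi> t = 0" if "t \<notin> {d..1-d}" for t
    using that left right by force
  ultimately show "prim \<psi> \<in> test_funs"
    unfolding test_funs_def using compact_Icc by blast
qed

text \<open>A product of two ramps: for n > 0 the left one is 0 up to 1/n and 1 from 2/n on, and the
  right one is its mirror image. For n \<le> 2 the function is identically 0.\<close>

definition cutoff :: "nat \<Rightarrow> real \<Rightarrow> real" where
  "cutoff n t = max 0 (min 1 (real n * t - 1)) * max 0 (min 1 (real n * (1 - t) - 1))"

lemma continuous_on_cutoff: "continuous_on A (cutoff n)"
  unfolding cutoff_def by (intro continuous_intros)

lemma cutoff_bounds: "\<bar>cutoff n t\<bar> \<le> 1"
  by (auto simp: cutoff_def abs_mult intro!: mult_le_one)

text \<open>The margin 1/(n+1) is slightly smaller than the true one, 1/n, but it is positive for n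
  = 0 too, where 1/n would be 0.\<close>

lemma cutoff_zero: "t \<le> 1 / (real n + 1) \<or> t \<ge> 1 - 1 / (real n + 1) \<Longrightarrow> cutoff n t = 0"
proof -
  assume "t \<le> 1 / (real n + 1) \<or> t \<ge> 1 - 1 / (real n + 1)"
  then have "t * (real n + 1) \<le> 1 \<or> (1 - t) * (real n + 1) \<le> 1"
    by (auto simp: field_simps)
  then have "real n * t \<le> 1 \<or> real n * (1 - t) \<le> 1 \<or> t < 0 \<or> t > 1"
    by (auto simp: algebra_simps)
  moreover have "t < 0 \<Longrightarrow> real n * t \<le> 0" "t > 1 \<Longrightarrow> real n * (1 - t) \<le> 0"
    by (auto simp: mult_nonneg_nonpos)
  ultimately show ?thesis by (auto simp: cutoff_def)
qed

lemma cutoff_eventually_1: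
  assumes "t \<in> {0<..<1}"
  shows "eventually (\<lambda>n. cutoff n t = 1) sequentially"
proof -
  obtain N where N: "real N \<ge> 2 / t" "real N \<ge> 2 / (1 - t)"
    using real_arch_simple[of "max (2 / t) (2 / (1 - t))"] by auto
  have "cutoff n t = 1" if "n \<ge> N" for n
  proof -
    have "real N \<le> real n" using that by simp
    then have "real n \<ge> 2 / t" "real n \<ge> 2 / (1 - t)" using N by linarith+
    then have "real n * t \<ge> 2" "real n * (1 - t) \<ge> 2" using assms by (auto simp: field_simps)
    then show ?thesis by (simp add: cutoff_def)
  qed
  then show ?thesis by (auto simp: eventually_sequentially)
qed

lemma cutoff_tendsto:
  fixes h :: "real \<Rightarrow> real"
  assumes "integrable U01 h"
  shows "(\<lambda>n. LINT t|U01. cutoff n t * h t) \<longlonglongrightarrow> integral\<^sup>L U01 h"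
proof (rule integral_dominated_convergence)
  show "integrable U01 (\<lambda>t. \<bar>h t\<bar>)" using assms by simp
  show "AE t in U01. (\<lambda>n. cutoff n t * h t) \<longlonglongrightarrow> h t"
  proof (rule AE_I2)
    fix t assume "t \<in> space U01"
    then have "t \<in> {0<..<1}" by simp
    from cutoff_eventually_1[OF this] have "eventually (\<lambda>n. cutoff n t * h t = h t) sequentially"
      by eventually_elim simp
    then show "(\<lambda>n. cutoff n t * h t) \<longlonglongrightarrow> h t" by (rule tendsto_eventually)
  qed
  show "AE t in U01. norm (cutoff n t * h t) \<le> \<bar>h t\<bar>" for n
    using cutoff_bounds[of n] by (intro AE_I2) (auto simp: abs_mult intro!: mult_left_le_one_le)
  show "h \<in> borel_measurable U01" using assms by simp
  then show "(\<lambda>t. cutoff n t * h t) \<in> borel_measurable U01" for n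
    by (intro borel_measurable_times measurable_U01_cont[OF continuous_on_cutoff])
qed

lemma measure_U01 [simp]: "measure U01 {0<..<1} = 1"
  using integral_U01_eq[OF integrable_U01_cont[of "\<lambda>_. 1"]] by simp

text \<open>The derivatives of test functions include all continuous functions of mean zero that
  vanish near the endpoints. A cutoff argument extends the orthogonality to every continuous p of
  mean zero; subtracting the mean from an arbitrary polynomial then shows that w minus its own mean
  is orthogonal to all polynomials.\<close>

lemma du_Bois_Reymond:
  fixes w :: "real \<Rightarrow> real"
  assumes w: "integrable U01 w"
    and test: "\<And>\<phi>. \<phi> \<in> test_funs \<Longrightarrow> (LINT t|U01. w t * deriv \<phi> t) = 0"
  shows "AE t in U01. w t = integral\<^sup>L U01 w"
proof -
  have mean0: "(LINT t|U01. p t * w t) = 0"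
    if p: "continuous_on UNIV p" and p0: "integral\<^sup>L U01 p = 0" for p
  proof -
    have p_int: "integrable U01 p"
      by (rule integrable_U01_cont[OF continuous_on_subset[OF p]]) simp
    have pw: "integrable U01 (\<lambda>t. p t * w t)"
      by (intro integrable_U01_mult_cont w continuous_on_subset[OF p]) simp
    have ci: "integrable U01 (\<lambda>t. cutoff n t * h t)" if "integrable U01 h" for h n
      by (intro integrable_U01_mult_cont that continuous_on_cutoff)
    have ci1: "integrable U01 (cutoff n)" for n
      by (intro integrable_U01_cont continuous_on_cutoff)
    define A where "A = (\<lambda>n. integral\<^sup>L U01 (cutoff n))"
    define B where "B = (\<lambda>n. LINT t|U01. cutoff n t * p t)"
    \<comment> \<open>Multiplying p by the cutoff destroys mean zero, and a multiple of the cutoff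
      restores it. Scaling by \<open>A n\<close> avoids a division by \<open>A n\<close>, which is 0
      for small n.\<close>
    define \<psi> where "\<psi> = (\<lambda>n t. A n * (cutoff n t * p t) - B n * cutoff n t)"
    have "(LINT t|U01. w t * \<psi> n t) = 0" for n
    proof -
      have cont: "continuous_on UNIV (\<psi> n)"
        unfolding \<psi>_def by (intro continuous_intros continuous_on_cutoff p)
      have zero: "\<psi> n t = 0" if "t \<le> 1 / (real n + 1) \<or> t \<ge> 1 - 1 / (real n + 1)" for t
        using cutoff_zero[OF that] by (simp add: \<psi>_def)
      have "integral\<^sup>L U01 (\<psi> n) = A n * B n - B n * A n"
        unfolding \<psi>_def A_def B_def
        by (subst Bochner_Integration.integral_diff) (use ci[OF p_int] ci1 in auto)
      then have "integral\<^sup>L U01 (\<psi> n) = 0" by simp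
      from test_funs_prim[of "\<psi> n" "1 / (real n + 1)", OF cont _ zero this]
      show ?thesis using test[of "prim (\<psi> n)"] by simp
    qed
    moreover have "(LINT t|U01. w t * \<psi> n t) =
        A n * (LINT t|U01. cutoff n t * (p t * w t)) - B n * (LINT t|U01. cutoff n t * w t)" for n
    proof -
      have "(LINT t|U01. w t * \<psi> n t) = (LINT t|U01. A n * (cutoff n t * (p t * w t)) - B n * (cutoff n t * w t))"
        unfolding \<psi>_def by (rule Bochner_Integration.integral_cong) (auto simp: algebra_simps)
      then show ?thesis
        by (simp add: Bochner_Integration.integral_diff ci pw w)
    qed
    ultimately have "(\<lambda>n. A n * (LINT t|U01. cutoff n t * (p t * w t)) - B n * (LINT t|U01. cutoff n t * w t)) \<longlonglongrightarrow> 0"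
      by simp
    moreover have "A \<longlonglongrightarrow> 1"
      using cutoff_tendsto[of "\<lambda>_. 1"] unfolding A_def by simp
    moreover have "B \<longlonglongrightarrow> 0"
      using cutoff_tendsto[OF p_int] unfolding B_def p0 .
    ultimately have "1 * (LINT t|U01. p t * w t) - 0 * integral\<^sup>L U01 w = 0"
      by (intro LIMSEQ_unique[OF tendsto_diff[OF tendsto_mult[OF _ cutoff_tendsto[OF pw]]
            tendsto_mult[OF _ cutoff_tendsto[OF w]]]])
    then show ?thesis by simp
  qed
  define k where "k = integral\<^sup>L U01 w"
  have "AE t in U01. w t - k = 0"
  proof (rule AE_zero_if_orthogonal_polynomials)
    show wk: "integrable U01 (\<lambda>t. w t - k)" using w by simp
    fix p :: "real \<Rightarrow> real" assume "real_polynomial_function p"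
    then have p: "continuous_on UNIV p"
      by (simp add: continuous_on_polymonial_function real_polynomial_function_eq)
    have p01: "continuous_on {0..1} p" by (rule continuous_on_subset[OF p]) simp
    have p_int: "integrable U01 p"
      by (rule integrable_U01_cont[OF p01])
    have pw: "integrable U01 (\<lambda>t. p t * w t)" by (intro integrable_U01_mult_cont w p01)
    define m where "m = integral\<^sup>L U01 p"
    have "(LINT t|U01. (p t - m) * w t) = 0"
    proof (rule mean0)
      show "continuous_on UNIV (\<lambda>t. p t - m)" by (intro continuous_intros p)
      show "(LINT t|U01. p t - m) = 0"
        using p_int by (simp add: m_def)
    qed
    moreover have "(LINT t|U01. (p t - m) * w t) = (LINT t|U01. p t * w t) - m * k"
      using pw w by (simp add: left_diff_distrib k_def)
    moreover have "(LINT t|U01. p t * (w t - k)) = (LINT t|U01. p t * w t) - m * k"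
      using pw p_int by (simp add: right_diff_distrib m_def)
    ultimately show "(LINT t|U01. p t * (w t - k)) = 0" by simp
  qed
  then show ?thesis by (simp add: k_def)
qed

lemma is_weak_deriv_prim:
  assumes "integrable U01 h"
  shows "is_weak_deriv (prim h) h"
  unfolding is_weak_deriv_def
proof
  fix \<phi> assume \<phi>: "\<phi> \<in> test_funs"
  have "(LINT t|U01. deriv \<phi> t * prim h t) = \<phi> 1 * integral\<^sup>L U01 h - (LINT t|U01. \<phi> t * h t)"
    by (rule integral_by_parts_prim[OF assms]) (use test_funsD[OF \<phi>] in auto)
  then show "(LINT t|U01. prim h t * deriv \<phi> t) = - (LINT t|U01. h t * \<phi> t)"
    using test_funsD(3)[OF \<phi>] by (simp add: mult.commute)
qed

lemma is_weak_deriv_cong: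
  assumes "AE t in U01. u t = u' t" "u \<in> borel_measurable U01" "u' \<in> borel_measurable U01"
  shows "is_weak_deriv u v \<longleftrightarrow> is_weak_deriv u' v"
proof -
  have "(LINT t|U01. u t * deriv \<phi> t) = (LINT t|U01. u' t * deriv \<phi> t)" if "\<phi> \<in> test_funs" for \<phi>
  proof (rule integral_cong_AE)
    have "deriv \<phi> \<in> borel_measurable U01"
      by (rule measurable_U01_cont[OF test_funsD(2)[OF that]])
    then show "(\<lambda>t. u t * deriv \<phi> t) \<in> borel_measurable U01" "(\<lambda>t. u' t * deriv \<phi> t) \<in> borel_measurable U01"
      using assms(2,3) by auto
  qed (use assms(1) in auto)
  then show ?thesis unfolding is_weak_deriv_def by simp
qed

text \<open>The function \<open>prim v\<close> has the same weak derivative as u, so the difference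
  is orthogonal to all derivatives of test functions.\<close>

lemma weak_deriv_imp_prim:
  assumes u: "integrable U01 u" and v: "integrable U01 v" and "is_weak_deriv u v"
  obtains k where "AE t in U01. u t = prim v t + k"
proof -
  have "AE t in U01. u t - prim v t = integral\<^sup>L U01 (\<lambda>t. u t - prim v t)"
  proof (rule du_Bois_Reymond)
    have pi: "integrable U01 (prim v)"
      by (intro integrable_U01_cont continuous_on_prim v)
    show "integrable U01 (\<lambda>t. u t - prim v t)" using u pi by simp
    fix \<phi> assume \<phi>: "\<phi> \<in> test_funs"
    have c: "continuous_on {0..1} (deriv \<phi>)" by (rule test_funsD(2)[OF \<phi>])
    have "(LINT t|U01. (u t - prim v t) * deriv \<phi> t) = (LINT t|U01. deriv \<phi> t * u t - deriv \<phi> t * prim v t)"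
      by (simp add: algebra_simps)
    also have "\<dots> = (LINT t|U01. deriv \<phi> t * u t) - (LINT t|U01. deriv \<phi> t * prim v t)"
      by (intro Bochner_Integration.integral_diff integrable_U01_mult_cont c u pi)
    also have "\<dots> = 0"
      using assms(3) is_weak_deriv_prim[OF v] \<phi> by (simp add: is_weak_deriv_def mult.commute)
    finally show "(LINT t|U01. (u t - prim v t) * deriv \<phi> t) = 0" .
  qed
  then have "AE t in U01. u t = prim v t + integral\<^sup>L U01 (\<lambda>t. u t - prim v t)"
    by eventually_elim simp
  then show ?thesis by (rule that)
qed

text \<open>Both primitives equal u up to a constant almost everywhere. Their difference is
  continuous, hence constant everywhere, and it vanishes at 0.\<close>

lemma weak_deriv_unique:
  assumes "integrable U01 u" "integrable U01 v" "integrable U01 v'" "is_weak_deriv u v" "is_weak_deriv u v'"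
  shows "AE t in U01. v t = v' t"
proof -
  obtain k where k: "AE t in U01. u t = prim v t + k" by (rule weak_deriv_imp_prim[OF assms(1,2,4)])
  obtain k' where k': "AE t in U01. u t = prim v' t + k'" by (rule weak_deriv_imp_prim[OF assms(1,3,5)])
  have d: "integrable U01 (\<lambda>t. 1 * v t + (-1) * v' t)" using assms by simp
  have p: "prim (\<lambda>t. 1 * v t + (-1) * v' t) t = prim v t - prim v' t" for t
    using prim_add[OF assms(2,3), of 1 "-1" t] by simp
  have "AE t in U01. prim (\<lambda>t. 1 * v t + (-1) * v' t) t = k' - k"
    unfolding p using k k' by eventually_elim simp
  from continuous_AE_const[OF continuous_on_prim[OF d] this]
  have "prim (\<lambda>t. 1 * v t + (-1) * v' t) t = k' - k" if "t \<in> {0..1}" for t using that .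
  from this this[of 0] have "prim (\<lambda>t. 1 * v t + (-1) * v' t) t = 0" if "t \<in> {0..1}" for t using that by simp
  from AE_zero_if_prim_zero[OF d this] show ?thesis by simp
qed

section \<open>The Hilbert space\<close>

lemma L2_measurable: "g \<in> L2 \<Longrightarrow> g \<in> borel_measurable U01"
  by (simp add: L2_def)

lemma L2_mult_integrable:
  assumes "g \<in> L2" "h \<in> L2"
  shows "integrable U01 (\<lambda>t. g t * h t)"
proof (rule Bochner_Integration.integrable_bound)
  show "integrable U01 (\<lambda>t. (g t)\<^sup>2 + (h t)\<^sup>2)" using assms by (simp add: L2_def)
  show "(\<lambda>t. g t * h t) \<in> borel_measurable U01"
    by (intro borel_measurable_times L2_measurable assms)
  have "\<bar>g t * h t\<bar> \<le> (g t)\<^sup>2 + (h t)\<^sup>2" for t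
  proof -
    have "2 * \<bar>g t\<bar> * \<bar>h t\<bar> \<le> \<bar>g t\<bar>\<^sup>2 + \<bar>h t\<bar>\<^sup>2" by (rule sum_squares_bound)
    moreover have "0 \<le> \<bar>g t\<bar> * \<bar>h t\<bar>" by simp
    ultimately show ?thesis unfolding abs_mult power2_abs by linarith
  qed
  then show "AE t in U01. norm (g t * h t) \<le> norm ((g t)\<^sup>2 + (h t)\<^sup>2)" by simp
qed

lemma L2_cont: "continuous_on {0..1} g \<Longrightarrow> g \<in> L2"
  by (auto simp: L2_def intro!: measurable_U01_cont integrable_U01_cont continuous_intros)

lemma L2_integrable: "g \<in> L2 \<Longrightarrow> integrable U01 g"
  using L2_mult_integrable[of g "\<lambda>_. 1"] L2_cont[of "\<lambda>_. 1"] by simp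

lemma L2_lincomb:
  assumes "g \<in> L2" "h \<in> L2"
  shows "(\<lambda>t. a * g t + b * h t) \<in> L2"
proof -
  have "integrable U01 (\<lambda>t. a\<^sup>2 * (g t * g t) + 2 * a * b * (g t * h t) + b\<^sup>2 * (h t * h t))"
    by (intro Bochner_Integration.integrable_add integrable_mult_right L2_mult_integrable assms)
  then have "integrable U01 (\<lambda>t. (a * g t + b * h t)\<^sup>2)"
    by (simp add: power2_eq_square algebra_simps)
  moreover have "(\<lambda>t. a * g t + b * h t) \<in> borel_measurable U01"
    by (intro borel_measurable_add borel_measurable_times borel_measurable_const L2_measurable assms)
  ultimately show ?thesis by (simp add: L2_def)
qed

lemma H1_wderiv:
  assumes "u \<in> H1"
  shows "wderiv u \<in> L2" "is_weak_deriv u (wderiv u)"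
proof -
  have "\<exists>v. v \<in> L2 \<and> is_weak_deriv u v" using assms by (auto simp: H1_def)
  from someI_ex[OF this] show "wderiv u \<in> L2" "is_weak_deriv u (wderiv u)"
    by (auto simp: wderiv_def)
qed

text \<open>The inverse of taking second derivatives in \<open>X\<close>: primitives start at 0,
  which builds in u(0) = u'(0) = 0, and the value 0 outside [0,1] follows the convention in
  \<open>X\<close>.\<close>

definition lift2 :: "(real \<Rightarrow> real) \<Rightarrow> real \<Rightarrow> real" where
  "lift2 g t = (if t \<in> {0..1} then prim (prim g) t else 0)"

lemma lift2_deriv:
  assumes "integrable U01 g" "t \<in> {0..1}"
  shows "(lift2 g has_real_derivative prim g t) (at t within {0..1})"
  by (rule has_field_derivative_transform_within[OF prim_deriv[OF continuous_on_prim[OF assms(1)] assms(2)] zero_less_one])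
    (use assms in \<open>auto simp: lift2_def\<close>)

lemma continuous_on_lift2: "integrable U01 g \<Longrightarrow> continuous_on {0..1} (lift2 g)"
  by (rule DERIV_continuous_on[OF lift2_deriv])

text \<open>Two applications of \<open>weak_deriv_imp_prim\<close> leave two integration constants,
  and the two boundary conditions at 0 remove them.\<close>

lemma X_eq_lift2:
  assumes "u \<in> X"
  shows "u = lift2 (wderiv (wderiv u))" "wderiv (wderiv u) \<in> L2"
proof -
  define v where "v = wderiv u"
  define g where "g = wderiv v"
  have u: "u \<in> H1" "v \<in> H1" and uc: "continuous_on {0..1} u"
    and out: "\<And>t. t \<notin> {0..1} \<Longrightarrow> u t = 0" and "u 0 = 0"
    and d0: "(u has_real_derivative 0) (at 0 within {0..1})"
    using assms by (auto simp: X_def H2_def v_def)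
  show "wderiv (wderiv u) \<in> L2" using H1_wderiv[OF u(2)] by (simp add: v_def)
  then have g: "g \<in> L2" by (simp add: g_def v_def)
  have v: "v \<in> L2" using H1_wderiv[OF u(1)] by (simp add: v_def)
  have uv: "is_weak_deriv u v" "is_weak_deriv v g"
    using H1_wderiv(2)[OF u(1)] H1_wderiv(2)[OF u(2)] by (auto simp: v_def g_def)
  note ig = L2_integrable[OF g] and iv = L2_integrable[OF v] and iu = integrable_U01_cont[OF uc]
  note cg = continuous_on_prim[OF ig]
  obtain k where k: "AE t in U01. v t = prim g t + k"
    by (rule weak_deriv_imp_prim[OF iv ig uv(2)])
  obtain l where l: "AE t in U01. u t = prim v t + l"
    by (rule weak_deriv_imp_prim[OF iu iv uv(1)])
  have k1: "continuous_on {0..1} (\<lambda>_. k)" by simp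
  have "prim v t = prim (\<lambda>t. 1 * prim g t + 1 * k) t" for t
    by (rule prim_cong_AE) (use k measurable_U01_cont[OF cg] L2_measurable[OF v] in auto)
  also have "\<dots> t = prim (prim g) t + prim (\<lambda>_. k) t" for t
    using prim_add[OF integrable_U01_cont[OF cg] integrable_U01_cont[OF k1], of 1 1 t] by simp
  finally have pv: "prim v t = prim (prim g) t + prim (\<lambda>_. k) t" for t .
  have "u t - prim v t = l" if "t \<in> {0..1}" for t
    by (rule continuous_AE_const[OF _ _ that])
      (use l uc continuous_on_prim[OF iv] in \<open>auto intro!: continuous_intros\<close>)
  from this this[of 0] have ut: "u t = prim (prim g) t + prim (\<lambda>_. k) t" if "t \<in> {0..1}" for t
    using that \<open>u 0 = 0\<close> pv by simp
  \<comment> \<open>The constant from u(0) = 0 is already gone. The derivative of the remaining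
    expression at 0 equals k because \<open>prim g 0\<close> is 0.\<close>
  have "(u has_real_derivative prim g 0 + k) (at 0 within {0..1})"
    by (rule has_field_derivative_transform_within[OF DERIV_add[OF prim_deriv[OF cg] prim_deriv[OF k1]] zero_less_one])
      (auto simp: ut)
  then have "prim g 0 + k = 0"
    using d0 by (rule has_field_derivative_unique) (simp add: trivial_limit_within)
  then have "k = 0" by simp
  have "u t = lift2 g t" for t
    using ut[of t] out[of t] by (simp add: lift2_def \<open>k = 0\<close> prim_def)
  then show "u = lift2 (wderiv (wderiv u))" by (auto simp: g_def v_def)
qed

text \<open>The chosen \<open>wderiv\<close> agrees with \<open>prim g\<close> only almost
  everywhere, so uniqueness of weak derivatives and \<open>is_weak_deriv_cong\<close> are needed
  before it can be differentiated again.\<close>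

lemma lift2_in_X:
  assumes g: "g \<in> L2"
  shows "lift2 g \<in> X" "AE t in U01. wderiv (wderiv (lift2 g)) t = g t"
proof -
  let ?u = "lift2 g" and ?v = "wderiv (lift2 g)"
  note ig = L2_integrable[OF g]
  note cg = continuous_on_prim[OF ig]
  note ip = integrable_U01_cont[OF cg]
  have u_L2: "?u \<in> L2" "prim g \<in> L2"
    by (intro L2_cont continuous_on_lift2 ig cg)+
  have "is_weak_deriv (prim (prim g)) (prim g)" by (rule is_weak_deriv_prim[OF ip])
  also have "is_weak_deriv (prim (prim g)) (prim g) \<longleftrightarrow> is_weak_deriv ?u (prim g)"
  proof (rule is_weak_deriv_cong)
    show "AE t in U01. prim (prim g) t = ?u t" by (rule AE_I2) (simp add: lift2_def)
    show "prim (prim g) \<in> borel_measurable U01" by (intro measurable_U01_cont continuous_on_prim ip)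
    show "?u \<in> borel_measurable U01" by (rule L2_measurable[OF u_L2(1)])
  qed
  finally have wd: "is_weak_deriv ?u (prim g)" .
  with u_L2 have uH1: "?u \<in> H1" by (auto simp: H1_def)
  note vL2 = H1_wderiv[OF uH1]
  have vp: "AE t in U01. prim g t = ?v t"
    using weak_deriv_unique[OF L2_integrable[OF u_L2(1)] ip L2_integrable[OF vL2(1)] wd vL2(2)] .
  have wd2: "is_weak_deriv ?v g"
    using is_weak_deriv_prim[OF ig] is_weak_deriv_cong[OF vp measurable_U01_cont[OF cg] L2_measurable[OF vL2(1)]] by simp
  then have vH1: "?v \<in> H1" using vL2(1) g by (auto simp: H1_def)
  note wL2 = H1_wderiv[OF vH1]
  show "AE t in U01. wderiv ?v t = g t"
    using weak_deriv_unique[OF L2_integrable[OF vL2(1)] L2_integrable[OF wL2(1)] ig wL2(2) wd2] .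
  show "?u \<in> X"
    unfolding X_def H2_def
    using uH1 vH1 continuous_on_lift2[OF ig] lift2_deriv[OF ig, of 0] by (auto simp: lift2_def)
qed

lemma lift2_lincomb:
  assumes "g \<in> L2" "h \<in> L2"
  shows "lift2 (\<lambda>t. a * g t + b * h t) t = a * lift2 g t + b * lift2 h t"
proof (cases "t \<in> {0..1}")
  case True
  note ig = L2_integrable[OF assms(1)] and ih = L2_integrable[OF assms(2)]
  have "prim (\<lambda>t. a * g t + b * h t) = (\<lambda>t. a * prim g t + b * prim h t)"
    using prim_add[OF ig ih] by auto
  then show ?thesis
    using True by (simp add: lift2_def prim_add integrable_U01_cont continuous_on_prim ig ih)
qed (auto simp: lift2_def)

text \<open>Being chosen representatives, second derivatives are linear only up to null sets. The
  combination is therefore recognised as \<open>lift2\<close> of the combined second derivatives,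
  for which membership is known.\<close>

lemma X_lincomb:
  assumes "u \<in> X" "v \<in> X"
  shows "(\<lambda>t. a * u t + b * v t) \<in> X"
    "AE t in U01. wderiv (wderiv (\<lambda>t. a * u t + b * v t)) t
        = a * wderiv (wderiv u) t + b * wderiv (wderiv v) t"
proof -
  let ?g = "wderiv (wderiv u)" and ?h = "wderiv (wderiv v)"
  note u = X_eq_lift2[OF assms(1)] and v = X_eq_lift2[OF assms(2)]
  have eq: "(\<lambda>t. a * u t + b * v t) = lift2 (\<lambda>t. a * ?g t + b * ?h t)"
    by (rule ext) (metis lift2_lincomb u v)
  show "(\<lambda>t. a * u t + b * v t) \<in> X"
    "AE t in U01. wderiv (wderiv (\<lambda>t. a * u t + b * v t)) t
        = a * wderiv (wderiv u) t + b * wderiv (wderiv v) t"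
    unfolding eq using lift2_in_X[OF L2_lincomb[OF u(2) v(2)]] by auto
qed

text \<open>\<open>X\<close> as a type of class \<open>real_inner\<close>, so that the library's inner products, norms and limits apply.\<close>

typedef beam = X
  using lift2_in_X(1)[OF L2_cont[of "\<lambda>_. 0"]] by auto

setup_lifting type_definition_beam

lift_definition app :: "beam \<Rightarrow> real \<Rightarrow> real" is "\<lambda>u. u" .

definition dd :: "beam \<Rightarrow> real \<Rightarrow> real" where
  "dd x = wderiv (wderiv (app x))"

lemma app_in_X [simp]: "app x \<in> X" by transfer

lemma dd_L2: "dd x \<in> L2"
  unfolding dd_def by (rule X_eq_lift2) simp

lemma app_eq_lift2: "app x = lift2 (dd x)"
  unfolding dd_def by (rule X_eq_lift2) simp

lemma beam_eqI: "(\<And>t. t \<in> {0..1} \<Longrightarrow> app x t = app y t) \<Longrightarrow> x = y"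
proof -
  assume *: "\<And>t. t \<in> {0..1} \<Longrightarrow> app x t = app y t"
  have "app x = app y"
    by (rule ext) (metis * app_eq_lift2 lift2_def)
  then show "x = y" by transfer
qed

instantiation beam :: real_vector
begin

lift_definition zero_beam :: beam is "\<lambda>_. 0"
  using X_lincomb(1)[of "lift2 (\<lambda>_. 0)" "lift2 (\<lambda>_. 0)" 0 0] lift2_in_X(1)[OF L2_cont[of "\<lambda>_. 0"]] by simp

lift_definition plus_beam :: "beam \<Rightarrow> beam \<Rightarrow> beam" is "\<lambda>u v t. u t + v t"
  subgoal for u v using X_lincomb(1)[of u v 1 1] by simp done

lift_definition minus_beam :: "beam \<Rightarrow> beam \<Rightarrow> beam" is "\<lambda>u v t. u t - v t"
  subgoal for u v using X_lincomb(1)[of u v 1 "-1"] by simp done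

lift_definition uminus_beam :: "beam \<Rightarrow> beam" is "\<lambda>u t. - u t"
  subgoal for u using X_lincomb(1)[of u u "-1" 0] by simp done

lift_definition scaleR_beam :: "real \<Rightarrow> beam \<Rightarrow> beam" is "\<lambda>a u t. a * u t"
  subgoal for a u using X_lincomb(1)[of u u a 0] by simp done

instance
  by standard (transfer; simp add: fun_eq_iff algebra_simps)+

end

lemma app_simps [simp]:
  "app 0 t = 0" "app (x + y) t = app x t + app y t" "app (x - y) t = app x t - app y t"
  "app (- x) t = - app x t" "app (a *\<^sub>R x) t = a * app x t"
  by (transfer; simp)+

lemma dd_lincomb: "AE t in U01. dd (a *\<^sub>R x + b *\<^sub>R y) t = a * dd x t + b * dd y t"
proof -
  have "app (a *\<^sub>R x + b *\<^sub>R y) = (\<lambda>t. a * app x t + b * app y t)" by auto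
  then show ?thesis
    unfolding dd_def using X_lincomb(2)[of "app x" "app y" a b] by simp
qed

lemma integral_dd_lincomb:
  assumes "g \<in> L2"
  shows "(LINT t|U01. dd (a *\<^sub>R x + b *\<^sub>R y) t * g t) = a * (LINT t|U01. dd x t * g t) + b * (LINT t|U01. dd y t * g t)"
proof -
  have "(LINT t|U01. dd (a *\<^sub>R x + b *\<^sub>R y) t * g t) = (LINT t|U01. a * (dd x t * g t) + b * (dd y t * g t))"
  proof (rule integral_cong_AE)
    show "AE t in U01. dd (a *\<^sub>R x + b *\<^sub>R y) t * g t = a * (dd x t * g t) + b * (dd y t * g t)"
      using dd_lincomb[of a x b y] by eventually_elim (simp add: algebra_simps)
  qed (use L2_measurable[OF assms] L2_measurable[OF dd_L2] in auto)
  also have "\<dots> = a * (LINT t|U01. dd x t * g t) + b * (LINT t|U01. dd y t * g t)"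
    by (subst Bochner_Integration.integral_add) (auto intro!: integrable_mult_right L2_mult_integrable dd_L2 assms)
  finally show ?thesis .
qed

text \<open>Definiteness of the inner product: by \<open>app_eq_lift2\<close> an element is the
  double primitive of its second derivative, with no affine part left over.\<close>

lemma eq_zero_if_dd_zero:
  assumes "(LINT t|U01. dd x t * dd x t) = 0"
  shows "x = 0"
proof -
  have "AE t in U01. dd x t * dd x t = 0"
    using assms by (subst (asm) integral_nonneg_eq_0_iff_AE) (auto intro: L2_mult_integrable dd_L2)
  then have "AE t in U01. dd x t = 0" by simp
  then have "prim (dd x) t = prim (\<lambda>_. 0) t" for t
    by (intro prim_cong_AE) (auto simp: L2_measurable[OF dd_L2])
  then have "prim (dd x) = (\<lambda>_. 0)" by (auto simp: prim_def)
  then have "app x t = 0" for t by (simp add: app_eq_lift2 lift2_def prim_def)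
  then show ?thesis by (intro beam_eqI) simp
qed

instantiation beam :: real_inner
begin

definition inner_beam :: "beam \<Rightarrow> beam \<Rightarrow> real" where
  "inner_beam x y = (LINT t|U01. dd x t * dd y t)"

definition norm_beam :: "beam \<Rightarrow> real" where
  "norm_beam x = sqrt (inner x x)"

definition dist_beam :: "beam \<Rightarrow> beam \<Rightarrow> real" where
  "dist_beam x y = norm (x - y)"

definition sgn_beam :: "beam \<Rightarrow> beam" where
  "sgn_beam x = x /\<^sub>R norm x"

definition uniformity_beam :: "(beam \<times> beam) filter" where
  "uniformity_beam = (INF e\<in>{0<..}. principal {(x, y). dist x y < e})"

definition open_beam :: "beam set \<Rightarrow> bool" where
  "open_beam S \<longleftrightarrow> (\<forall>x\<in>S. \<forall>\<^sub>F (x', y) in uniformity. x' = x \<longrightarrow> y \<in> S)"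

instance
proof
  fix x y z :: beam and r :: real
  show "inner x y = inner y x" by (simp add: inner_beam_def mult.commute)
  show "inner (x + y) z = inner x z + inner y z"
    using integral_dd_lincomb[OF dd_L2[of z], of 1 x 1 y] by (simp add: inner_beam_def)
  show "inner (r *\<^sub>R x) y = r * inner x y"
    using integral_dd_lincomb[OF dd_L2[of y], of r x 0 x] by (simp add: inner_beam_def)
  show "0 \<le> inner x x" by (simp add: inner_beam_def)
  show "inner x x = 0 \<longleftrightarrow> x = 0"
  proof
    assume "x = 0"
    then show "inner x x = 0"
      using integral_dd_lincomb[OF dd_L2[of x], of 0 x 0 x] by (simp add: inner_beam_def)
  qed (simp add: inner_beam_def eq_zero_if_dd_zero)
qed (fact dist_beam_def sgn_beam_def uniformity_beam_def open_beam_def norm_beam_def)+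

end

lemma normX_app: "normX (app x) = norm x"
  by (simp add: normX_def norm_beam_def inner_beam_def dd_def power2_eq_square)

section \<open>The linear problem\<close>

text \<open>The mean value theorem for g - f. Derivatives are required only inside the interval, so
  \<open>powr\<close> in \<open>M1\<close> is differentiated only at positive arguments.\<close>

lemma diff_le_if_deriv_le:
  fixes f g :: "real \<Rightarrow> real"
  assumes "a \<le> b" "continuous_on {a..b} f" "continuous_on {a..b} g"
    and f: "\<And>x. a < x \<Longrightarrow> x < b \<Longrightarrow> (f has_real_derivative f' x) (at x)"
    and g: "\<And>x. a < x \<Longrightarrow> x < b \<Longrightarrow> (g has_real_derivative g' x) (at x)"
    and le: "\<And>x. a < x \<Longrightarrow> x < b \<Longrightarrow> f' x \<le> g' x"
  shows "f b - f a \<le> g b - g a"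
proof (cases "a = b")
  case False
  then have ab: "a < b" using assms(1) by simp
  let ?h = "\<lambda>x. g x - f x"
  have der: "(?h has_real_derivative g' x - f' x) (at x)" if "a < x" "x < b" for x
    by (rule DERIV_diff[OF g[OF that] f[OF that]])
  have "\<exists>l z. a < z \<and> z < b \<and> DERIV ?h z :> l \<and> ?h b - ?h a = (b - a) * l"
    by (rule MVT[OF ab]) (use der assms(2,3) in \<open>auto intro!: continuous_intros simp: real_differentiable_def\<close>)
  then obtain l z where z: "a < z" "z < b" "DERIV ?h z :> l" "?h b - ?h a = (b - a) * l"
    by blast
  have "l = g' z - f' z" by (rule DERIV_unique[OF z(3) der[OF z(1,2)]])
  then have "0 \<le> (b - a) * l" using le[OF z(1,2)] ab by simp
  then show ?thesis using z(4) by linarith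
qed simp

lemma DERIV_interior_01:
  assumes "(f has_real_derivative D) (at t within {0..1})" "0 < t" "t < 1"
  shows "(f has_real_derivative D) (at t)"
  using assms by (simp add: at_within_Icc_at)

lemma diff_le_if_deriv_le_01:
  fixes f g :: "real \<Rightarrow> real"
  assumes f: "\<And>x. x \<in> {0..1} \<Longrightarrow> (f has_real_derivative f' x) (at x within {0..1})"
    and g: "\<And>x. x \<in> {0..1} \<Longrightarrow> (g has_real_derivative g' x) (at x within {0..1})"
    and ab: "0 \<le> a" "a \<le> b" "b \<le> 1"
    and le: "\<And>x. a < x \<Longrightarrow> x < b \<Longrightarrow> f' x \<le> g' x"
  shows "f b - f a \<le> g b - g a"
proof (rule diff_le_if_deriv_le[OF \<open>a \<le> b\<close>])
  show "continuous_on {a..b} f" "continuous_on {a..b} g"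
    using ab by (auto intro: continuous_on_subset[OF DERIV_continuous_on[OF f]]
        continuous_on_subset[OF DERIV_continuous_on[OF g]])
  show "(f has_real_derivative f' x) (at x)" "(g has_real_derivative g' x) (at x)"
    if "a < x" "x < b" for x
    using ab that by (intro DERIV_interior_01 f g; simp)+
qed (use le in auto)

lemma convex_on_01_if_deriv_mono:
  fixes f :: "real \<Rightarrow> real"
  assumes f: "\<And>x. x \<in> {0..1} \<Longrightarrow> (f has_real_derivative f' x) (at x within {0..1})"
    and mono: "mono_on {0..1} f'"
  shows "convex_on {0..1} f"
proof -
  \<comment> \<open>A monotone derivative puts the graph above each tangent. At an intermediate
    point z, the weighted average of the tangent values at x and y is f(z) itself, which gives
    convexity.\<close>
  have tangent: "f z + f' z * (y - z) \<le> f y" if "z \<in> {0..1}" "y \<in> {0..1}" for y z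
  proof -
    have lin: "((\<lambda>y. f' z * y) has_real_derivative f' z) (at x within {0..1})" for x
      by (auto intro!: derivative_eq_intros)
    show ?thesis
    proof (cases "z \<le> y")
      case True
      have "f' z * y - f' z * z \<le> f y - f z"
        by (rule diff_le_if_deriv_le_01[OF lin f]) (use that True mono in \<open>auto simp: mono_on_def\<close>)
      then show ?thesis by (simp add: algebra_simps)
    next
      case False
      have "f z - f y \<le> f' z * z - f' z * y"
        by (rule diff_le_if_deriv_le_01[OF f lin]) (use that False mono in \<open>auto simp: mono_on_def\<close>)
      then show ?thesis by (simp add: algebra_simps)
    qed
  qed
  show ?thesis
  proof (rule convex_on_linorderI)
    fix t x y :: real assume t: "0 < t" "t < 1" and xy: "x \<in> {0..1}" "y \<in> {0..1}"
    define z where "z = (1 - t) * x + t * y"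
    have "z \<in> {0..1}"
      using convexD_alt[of "{0..1::real}" x y t] t xy by (simp add: z_def)
    from tangent[OF this xy(1)] tangent[OF this xy(2)]
    have "(1 - t) * (f z + f' z * (x - z)) + t * (f z + f' z * (y - z)) \<le> (1 - t) * f x + t * f y"
      using t by (intro add_mono mult_left_mono) auto
    moreover have "(1 - t) * (f z + f' z * (x - z)) + t * (f z + f' z * (y - z)) = f z"
      unfolding z_def by (simp add: algebra_simps)
    ultimately show "f ((1 - t) *\<^sub>R x + t *\<^sub>R y) \<le> (1 - t) * f x + t * f y"
      by (simp add: z_def)
  qed simp
qed

section \<open>Construction from second derivatives and pointwise bounds by the norm\<close>

lemma norm_beam_sq: "(norm (x::beam))\<^sup>2 = inner x x"
  by (rule power2_norm_eq_inner)

definition beam_of :: "(real \<Rightarrow> real) \<Rightarrow> beam" where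
  "beam_of g = Abs_beam (lift2 g)"

lemma app_beam_of: "g \<in> L2 \<Longrightarrow> app (beam_of g) = lift2 g"
  by (simp add: beam_of_def app.rep_eq Abs_beam_inverse lift2_in_X)

lemma dd_beam_of: "g \<in> L2 \<Longrightarrow> AE t in U01. dd (beam_of g) t = g t"
  by (simp add: dd_def app_beam_of lift2_in_X)

lemma inner_beam_of:
  assumes "g \<in> L2"
  shows "inner (beam_of g) x = (LINT t|U01. g t * dd x t)"
  unfolding inner_beam_def
proof (rule integral_cong_AE)
  show "AE t in U01. dd (beam_of g) t * dd x t = g t * dd x t"
    using dd_beam_of[OF assms] by eventually_elim simp
qed (use L2_measurable[OF assms] L2_measurable[OF dd_L2] in auto)

lemma norm_beam_of:
  assumes "g \<in> L2"
  shows "(norm (beam_of g))\<^sup>2 = (LINT t|U01. (g t)\<^sup>2)"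
  unfolding norm_beam_sq inner_beam_of[OF assms]
proof (rule integral_cong_AE)
  show "AE t in U01. g t * dd (beam_of g) t = (g t)\<^sup>2"
    using dd_beam_of[OF assms] by eventually_elim (simp add: power2_eq_square)
qed (use L2_measurable[OF assms] L2_measurable[OF dd_L2] in auto)

lemma app_deriv:
  "t \<in> {0..1} \<Longrightarrow> (app x has_real_derivative prim (dd x) t) (at t within {0..1})"
  using lift2_deriv[OF L2_integrable[OF dd_L2]] by (simp add: app_eq_lift2)

lemma continuous_on_app: "continuous_on {0..1} (app x)"
  by (rule DERIV_continuous_on[OF app_deriv])

lemma app_0 [simp]: "app x 0 = 0"
  by (simp add: app_eq_lift2 lift2_def)

text \<open>\<open>prim (dd x) t\<close> is the inner product of \<open>x\<close> with the element whose second derivative is the indicator of \<open>[0,t]\<close>.\<close>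

lemma prim_dd_le:
  assumes "t \<in> {0..1}"
  shows "\<bar>prim (dd x) t\<bar> \<le> sqrt t * norm x"
proof -
  let ?g = "indicator {..t} :: real \<Rightarrow> real"
  have sq: "(\<lambda>s. (?g s)\<^sup>2) = (\<lambda>s. ?g s * 1)" by (auto simp: indicator_def)
  have "integrable U01 ?g"
    using integrable_indicator_mult[of "\<lambda>_. 1" t] by simp
  then have g: "?g \<in> L2" by (simp add: L2_def sq)
  have "(LINT s|U01. ?g s * 1) = t"
    using prim_eq_integral[of "\<lambda>_. 1" t] assms unfolding prim_def by simp
  then have "(norm (beam_of ?g))\<^sup>2 = t"
    unfolding norm_beam_of[OF g] sq .
  then have n: "norm (beam_of ?g) = sqrt t" by (metis norm_ge_zero real_sqrt_unique)
  have "prim (dd x) t = inner (beam_of ?g) x"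
    by (simp add: inner_beam_of[OF g] prim_def)
  also have "\<bar>\<dots>\<bar> \<le> sqrt t * norm x"
    using Cauchy_Schwarz_ineq2[of "beam_of ?g" x] n by simp
  finally show ?thesis .
qed

lemma continuous_on_M1: "continuous_on {0..1} M1"
  unfolding M1_def
  by (intro continuous_on_mult continuous_on_const continuous_on_powr' continuous_on_id) auto

lemma M1_bounds: "t \<in> {0..1} \<Longrightarrow> 0 \<le> M1 t \<and> M1 t \<le> 1"
  using powr_mono2[of "3/2" t 1] by (auto simp: M1_def)

text \<open>Integrating |u'(s)| \<le> sqrt s |u| from 0 to t gives the factor (2/3) t^(3/2), which
  is \<open>M1\<close>.\<close>

lemma app_le_M1:
  assumes t: "t \<in> {0..1}"
  shows "\<bar>app x t\<bar> \<le> M1 t * norm x"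
proof -
  have le: "app x t \<le> M1 t * norm x" for x
  proof -
    have "app x t - app x 0 \<le> M1 t * norm x - M1 0 * norm x"
    proof (rule diff_le_if_deriv_le)
      show "continuous_on {0..t} (app x)" "continuous_on {0..t} (\<lambda>t. M1 t * norm x)"
        using t by (auto intro!: continuous_intros continuous_on_subset[OF continuous_on_app]
            continuous_on_subset[OF continuous_on_M1])
      fix s assume s: "0 < s" "s < t"
      show "(app x has_real_derivative prim (dd x) s) (at s)"
        using s t by (intro DERIV_interior_01 app_deriv) auto
      show "((\<lambda>t. M1 t * norm x) has_real_derivative sqrt s * norm x) (at s)"
        unfolding M1_def using s by (auto intro!: derivative_eq_intros simp: powr_half_sqrt)
      show "prim (dd x) s \<le> sqrt s * norm x"
        using prim_dd_le[of s x] s t by auto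
    qed (use t in auto)
    then show ?thesis by (simp add: M1_def)
  qed
  from le[of x] le[of "- x"] show ?thesis by auto
qed

lemma app_le_norm:
  assumes t: "t \<in> {0..1}"
  shows "\<bar>app x t\<bar> \<le> norm x"
  using app_le_M1[OF t, of x] M1_bounds[OF t] mult_right_mono[of "M1 t" 1 "norm x"] by simp

text \<open>Norm-bounded sets are thereby equicontinuous, as the theorem of Arzela and Ascoli
  requires.\<close>

lemma app_Lipschitz:
  assumes "s \<in> {0..1}" "t \<in> {0..1}"
  shows "\<bar>app x s - app x t\<bar> \<le> norm x * \<bar>s - t\<bar>"
proof -
  have "norm (app x s - app x t) \<le> norm x * norm (s - t)"
  proof (rule field_differentiable_bound[OF _ app_deriv])
    fix z :: real assume z: "z \<in> {0..1}"
    then have "sqrt z * norm x \<le> 1 * norm x" by (intro mult_right_mono) auto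
    then show "norm (prim (dd x) z) \<le> norm x"
      using prim_dd_le[OF z, of x] by simp
  qed (use assms in auto)
  then show ?thesis by simp
qed

text \<open>On [0,1] this is the integral over [t,1] of an integrable g. Integrating from the right
  builds in the conditions u''(1) = u'''(1) = 0 at the free end.\<close>

definition tail :: "(real \<Rightarrow> real) \<Rightarrow> real \<Rightarrow> real" where
  "tail g t = prim g 1 - prim g t"

lemma tail_deriv:
  assumes "continuous_on {0..1} g" "t \<in> {0..1}"
  shows "(tail g has_real_derivative - g t) (at t within {0..1})"
  unfolding tail_def using DERIV_diff[OF DERIV_const prim_deriv[OF assms]] by simp

lemma continuous_on_tail: "continuous_on {0..1} g \<Longrightarrow> continuous_on {0..1} (tail g)"
  by (rule DERIV_continuous_on[OF tail_deriv])

lemma tail_1 [simp]: "tail g 1 = 0"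
  by (simp add: tail_def)

text \<open>For continuous g, the second derivative is \<open>tail (tail g)\<close>, the third
  \<open>- tail g\<close> and the fourth g; the conditions at 0 come from
  \<open>lift2\<close>.\<close>

definition solve :: "(real \<Rightarrow> real) \<Rightarrow> beam" where
  "solve g = beam_of (tail (tail g))"

lemma tail2_L2: "continuous_on {0..1} g \<Longrightarrow> tail (tail g) \<in> L2"
  by (intro L2_cont continuous_on_tail)

text \<open>Two integrations by parts move both derivatives off x. The boundary terms vanish because
  tails are 0 at 1 and primitives are 0 at 0. Thus \<open>solve g\<close> is the Riesz
  representative of integration against g.\<close>

lemma inner_solve:
  assumes g: "continuous_on {0..1} g"
  shows "inner (solve g) x = integral {0..1} (\<lambda>t. g t * app x t)"
proof -
  note ix = L2_integrable[OF dd_L2[of x]]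
  note cg = continuous_on_tail[OF g]
  note cp = continuous_on_prim[OF ix]
  have "(LINT t|U01. - tail g t * prim (dd x) t) =
      tail (tail g) 1 * integral\<^sup>L U01 (dd x) - (LINT t|U01. tail (tail g) t * dd x t)"
    by (rule integral_by_parts_prim[OF ix tail_deriv[OF cg]]) (auto intro: continuous_intros cg)
  then have "inner (solve g) x = (LINT t|U01. tail g t * prim (dd x) t)"
    by (simp add: solve_def inner_beam_of[OF tail2_L2[OF g]])
  moreover have "(LINT t|U01. - g t * prim (prim (dd x)) t) =
      tail g 1 * integral\<^sup>L U01 (prim (dd x)) - (LINT t|U01. tail g t * prim (dd x) t)"
    by (rule integral_by_parts_prim[OF integrable_U01_cont[OF cp] tail_deriv[OF g]])
      (auto intro: continuous_intros g)
  moreover have "(LINT t|U01. - g t * prim (prim (dd x)) t) = (LINT t|U01. - (g t * app x t))"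
    by (rule Bochner_Integration.integral_cong) (auto simp: app_eq_lift2 lift2_def)
  ultimately have "inner (solve g) x = (LINT t|U01. g t * app x t)" by simp
  also have "\<dots> = integral {0..1} (\<lambda>t. g t * app x t)"
    by (intro integral_U01_eq integrable_U01_cont continuous_intros g continuous_on_app)
  finally show ?thesis .
qed

lemma abs_integral_le:
  fixes h :: "real \<Rightarrow> real"
  assumes "continuous_on {0..1} h" "\<And>t. t \<in> {0..1} \<Longrightarrow> \<bar>h t\<bar> \<le> B"
  shows "\<bar>integral {0..1} h\<bar> \<le> B"
  using integral_bound[of 0 1 h B] assms by simp

text \<open>Pair the difference with itself and bound its values by its norm; one factor of the norm
  cancels. Uniform closeness of right-hand sides thus becomes closeness in \<open>X\<close>, the
  mechanism behind both continuity and compactness of \<open>N\<close>.\<close>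

lemma norm_solve_diff_le:
  assumes g: "continuous_on {0..1} g" and h: "continuous_on {0..1} h"
    and le: "\<And>t. t \<in> {0..1} \<Longrightarrow> \<bar>g t - h t\<bar> \<le> e"
  shows "norm (solve g - solve h) \<le> e"
proof -
  let ?d = "solve g - solve h"
  have c: "continuous_on {0..1} (\<lambda>t. (g t - h t) * app ?d t)"
    by (intro continuous_intros g h continuous_on_app)
  have "(norm ?d)\<^sup>2 = inner (solve g) ?d - inner (solve h) ?d"
    by (simp add: norm_beam_sq inner_diff_left)
  also have "\<dots> = integral {0..1} (\<lambda>t. (g t - h t) * app ?d t)"
    unfolding inner_solve[OF g] inner_solve[OF h] left_diff_distrib
    by (rule Henstock_Kurzweil_Integration.integral_diff[symmetric])
      (auto intro!: integrable_continuous_interval continuous_intros g h continuous_on_app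
        simp del: app_simps)
  also have "\<dots> \<le> e * norm ?d"
  proof -
    have "\<bar>(g t - h t) * app ?d t\<bar> \<le> e * norm ?d" if "t \<in> {0..1}" for t
    proof -
      have "0 \<le> e" using le[OF that] by linarith
      then show ?thesis
        unfolding abs_mult by (intro mult_mono le[OF that] app_le_norm that) auto
    qed
    from abs_integral_le[OF c this] show ?thesis by linarith
  qed
  finally have *: "norm ?d * norm ?d \<le> e * norm ?d" by (simp add: power2_eq_square)
  have "0 \<le> e" using le[of 0] by auto
  then show ?thesis using * by (cases "norm ?d = 0") (auto simp: mult_le_cancel_right)
qed

lemma app_solve_deriv:
  assumes g: "continuous_on {0..1} g" and t: "t \<in> {0..1}"
  shows "(app (solve g) has_real_derivative prim (tail (tail g)) t) (at t within {0..1})"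
    "(prim (tail (tail g)) has_real_derivative tail (tail g) t) (at t within {0..1})"
  using lift2_deriv[OF L2_integrable[OF tail2_L2[OF g]] t]
    prim_deriv[OF continuous_on_tail[OF continuous_on_tail[OF g]] t]
  by (simp_all add: solve_def app_beam_of[OF tail2_L2[OF g]])

lemma solution_solve:
  assumes g: "continuous_on {0..1} g" and eq: "\<And>t. t \<in> {0..1} \<Longrightarrow> g t = f t (app (solve g) t)"
  shows "solution f (app (solve g))"
  unfolding solution_def
proof (intro exI conjI ballI)
  fix t :: real assume t: "t \<in> {0..1}"
  show "(app (solve g) has_real_derivative prim (tail (tail g)) t) (at t within {0..1})"
    "(prim (tail (tail g)) has_real_derivative tail (tail g) t) (at t within {0..1})"
    by (rule app_solve_deriv[OF g t])+
  show "(tail (tail g) has_real_derivative - tail g t) (at t within {0..1})"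
    by (rule tail_deriv[OF continuous_on_tail[OF g] t])
  show "((\<lambda>t. - tail g t) has_real_derivative g t) (at t within {0..1})"
    using DERIV_minus[OF tail_deriv[OF g t]] by simp
qed (use g eq in auto)

text \<open>The substitution x to t + (1 - t) x carries [0,1] onto [t,1] and contributes the factor
  1 - t. Both sides vanish at y = 1, so comparing derivatives on [y,1] suffices.\<close>

lemma tail_scaled_mono:
  assumes h: "continuous_on {0..1} h" and k: "continuous_on {0..1} k" and t: "0 \<le> t" "t < 1"
    and le: "\<And>x. 0 < x \<Longrightarrow> x < 1 \<Longrightarrow> c * k x \<le> h (t + (1 - t) * x)"
    and y: "y \<in> {0..1}"
  shows "(1 - t) * c * tail k y \<le> tail h (t + (1 - t) * y)"
proof -
  have in01: "t + (1 - t) * x \<in> {0..1}" if "x \<in> {0..1}" for x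
    using convexD_alt[of "{0..1::real}" t 1 x] t that by (simp add: algebra_simps)
  have "tail h (t + (1 - t) * 1) - tail h (t + (1 - t) * y) \<le>
      (1 - t) * c * tail k 1 - (1 - t) * c * tail k y"
  proof (rule diff_le_if_deriv_le[where f = "\<lambda>x. tail h (t + (1 - t) * x)" and g = "\<lambda>x. (1 - t) * c * tail k x"])
    show "continuous_on {y..1} (\<lambda>x. tail h (t + (1 - t) * x))"
    proof (rule continuous_on_compose2[OF continuous_on_tail[OF h]])
      show "(\<lambda>x. t + (1 - t) * x) ` {y..1} \<subseteq> {0..1}"
      proof (rule image_subsetI)
        show "t + (1 - t) * x \<in> {0..1}" if "x \<in> {y..1}" for x
          by (rule in01) (use that y in auto)
      qed
    qed (intro continuous_intros)
    show "continuous_on {y..1} (\<lambda>x. (1 - t) * c * tail k x)"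
      using y by (intro continuous_intros continuous_on_subset[OF continuous_on_tail[OF k]]) auto
    fix x assume x: "y < x" "x < 1"
    then have x01: "0 < x" "x < 1" using y by auto
    have "0 < (1 - t) * x" "(1 - t) * x < 1 - t" using t x01 by auto
    then have z: "0 < t + (1 - t) * x" "t + (1 - t) * x < 1" using t by linarith+
    show "((\<lambda>x. tail h (t + (1 - t) * x)) has_real_derivative - h (t + (1 - t) * x) * (1 - t)) (at x)"
    proof (rule DERIV_chain2[where f = "tail h" and g = "\<lambda>x. t + (1 - t) * x"])
      show "(tail h has_real_derivative - h (t + (1 - t) * x)) (at (t + (1 - t) * x))"
        using z by (intro DERIV_interior_01 tail_deriv[OF h]) auto
      show "((\<lambda>x. t + (1 - t) * x) has_real_derivative 1 - t) (at x)"
        by (auto intro!: derivative_eq_intros)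
    qed
    show "((\<lambda>x. (1 - t) * c * tail k x) has_real_derivative (1 - t) * c * (- k x)) (at x)"
      by (intro DERIV_cmult DERIV_interior_01 tail_deriv[OF k]) (use x01 in auto)
    show "- h (t + (1 - t) * x) * (1 - t) \<le> (1 - t) * c * (- k x)"
      using mult_left_mono[OF le[OF x01], of "1 - t"] t by (simp add: algebra_simps)
  qed (use y in auto)
  then show ?thesis by simp
qed

lemma tail_antimono:
  assumes g: "continuous_on {0..1} g" and "\<And>t. t \<in> {0..1} \<Longrightarrow> 0 \<le> g t"
    and "0 \<le> s" "s \<le> t" "t \<le> 1"
  shows "tail g t \<le> tail g s"
proof -
  have "tail g t - tail g s \<le> 0 - 0"
    by (rule diff_le_if_deriv_le_01[OF tail_deriv[OF g], of "\<lambda>_. 0" "\<lambda>_. 0"]) (use assms in auto)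
  then show ?thesis by simp
qed

lemma tail_nonneg:
  assumes "continuous_on {0..1} g" "\<And>t. t \<in> {0..1} \<Longrightarrow> 0 \<le> g t" "t \<in> {0..1}"
  shows "0 \<le> tail g t"
  using tail_antimono[OF assms(1,2), of t 1] assms(3) by simp

text \<open>
  For nondecreasing \<open>g\<close>, rescaling \<open>[0,1]\<close> to \<open>[t,1]\<close> in \<open>w''(t) = \<integral>\<^sub>t\<^sup>1 (s - t) g(s) ds\<close> gives
  \<open>w''(t) \<ge> (1 - t)\<^sup>2 w''(0)\<close>, while \<open>|w| \<le> w''(0)\<close>.
\<close>

lemma solve_Harnack:
  assumes g: "continuous_on {0..1} g" and nonneg: "\<And>t. t \<in> {0..1} \<Longrightarrow> 0 \<le> g t"
    and mono: "mono_on {0..1} g" and t: "t \<in> {0..1}"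
  shows "M0 t * norm (solve g) \<le> app (solve g) t"
proof -
  let ?H = "tail (tail g)"
  note cg = continuous_on_tail[OF g]
  note cH = continuous_on_tail[OF cg]
  have tg: "0 \<le> tail g t" if "t \<in> {0..1}" for t by (rule tail_nonneg[OF g nonneg that])
  have H_nonneg: "0 \<le> ?H t" if "t \<in> {0..1}" for t by (rule tail_nonneg[OF cg tg that])
  have H_lower: "?H 0 * (1 - t)\<^sup>2 \<le> ?H t" if t: "t \<in> {0..1}" for t
  proof (cases "t = 1")
    case False
    then have t': "0 \<le> t" "t < 1" using t by auto
    \<comment> \<open>The rescaled point lies to the right of x, so monotonicity of g starts the
      comparison with constant 1. Each of the two tails then contributes a factor 1 - t.\<close>
    have 1: "1 * g x \<le> g (t + (1 - t) * x)" if "0 < x" "x < 1" for x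
    proof -
      have "(1 - t) * x \<le> 1 - t" "0 \<le> t * (1 - x)" using that t' by (auto simp: mult_left_le)
      then have "t + (1 - t) * x \<in> {0..1}" "x \<le> t + (1 - t) * x"
        using that t' by (auto simp: algebra_simps)
      then show ?thesis using mono that by (simp add: mono_on_def)
    qed
    have 2: "(1 - t) * tail g x \<le> tail g (t + (1 - t) * x)" if "0 < x" "x < 1" for x
      using tail_scaled_mono[OF g g t' 1, of x] that by simp
    show ?thesis
      using tail_scaled_mono[OF cg cg t' 2, of 0] by (simp add: power2_eq_square mult.commute)
  qed simp
  have norm_le: "norm (solve g) \<le> ?H 0"
  proof -
    have c: "continuous_on {0..1} (\<lambda>t. (?H t)\<^sup>2)" by (intro continuous_intros cH)
    have "(norm (solve g))\<^sup>2 = integral {0..1} (\<lambda>t. (?H t)\<^sup>2)"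
      unfolding solve_def norm_beam_of[OF tail2_L2[OF g]]
      by (rule integral_U01_eq[OF integrable_U01_cont[OF c]])
    also have "\<dots> \<le> (?H 0)\<^sup>2"
    proof -
      have "\<bar>(?H t)\<^sup>2\<bar> \<le> (?H 0)\<^sup>2" if "t \<in> {0..1}" for t
        using tail_antimono[OF cg tg, of 0 t] H_nonneg[OF that] that by (auto intro: power_mono)
      from abs_integral_le[OF c this] show ?thesis by linarith
    qed
    finally show ?thesis by (rule power2_le_imp_le) (simp add: H_nonneg)
  qed
  \<comment> \<open>The polynomial is the integral of (1 - s)^2 over [0,t]; the one in
    \<open>w0\<close> is its primitive.\<close>
  have w1: "?H 0 * (t - t\<^sup>2 + t^3/3) \<le> prim ?H t" if t: "t \<in> {0..1}" for t
  proof -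
    have "?H 0 * (t - t\<^sup>2 + t^3/3) - ?H 0 * (0 - 0\<^sup>2 + 0^3/3) \<le> prim ?H t - prim ?H 0"
      by (rule diff_le_if_deriv_le_01[where f = "\<lambda>t. ?H 0 * (t - t\<^sup>2 + t^3/3)"
            and f' = "\<lambda>t. ?H 0 * (1 - t)\<^sup>2", OF _ prim_deriv[OF cH]])
        (use t H_lower in \<open>auto intro!: derivative_eq_intros simp: power2_eq_square algebra_simps\<close>)
    then show ?thesis by simp
  qed
  have w0: "?H 0 * (t\<^sup>2/2 - t^3/3 + t^4/12) \<le> app (solve g) t"
  proof -
    have "?H 0 * (t\<^sup>2/2 - t^3/3 + t^4/12) - ?H 0 * (0\<^sup>2/2 - 0^3/3 + 0^4/12) \<le> app (solve g) t - app (solve g) 0"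
      by (rule diff_le_if_deriv_le_01[where f = "\<lambda>t. ?H 0 * (t\<^sup>2/2 - t^3/3 + t^4/12)"
            and f' = "\<lambda>t. ?H 0 * (t - t\<^sup>2 + t^3/3)", OF _ app_solve_deriv(1)[OF g]])
        (use t w1 in \<open>auto intro!: derivative_eq_intros simp: field_simps eval_nat_numeral\<close>)
    then show ?thesis by simp
  qed
  \<comment> \<open>A rational bound on the constant in \<open>M0\<close> leaves a comparison of
    polynomials.\<close>
  have "sqrt 2 \<le> 3 / 2" by (rule real_le_lsqrt) (auto simp: power2_eq_square)
  then have "M0 t \<le> (3/2) * (1 - t) * t^3 / 6"
    unfolding M0_def using t by (intro divide_right_mono mult_right_mono) auto
  also have "\<dots> \<le> t\<^sup>2/2 - t^3/3 + t^4/12"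
  proof -
    \<comment> \<open>Dividing the difference by t^2 leaves t^2/3 - 7t/12 + 1/2; completing the
      square leaves the positive constant 1/2 - 49/192.\<close>
    have "0 \<le> t\<^sup>2 * ((4 * t - 7/2)\<^sup>2 / 48 + (1/2 - 49/192))" by (intro mult_nonneg_nonneg add_nonneg_nonneg) auto
    also have "\<dots> = (t\<^sup>2/2 - t^3/3 + t^4/12) - (3/2) * (1 - t) * t^3 / 6"
      by (simp add: field_simps eval_nat_numeral)
    finally show ?thesis by simp
  qed
  finally have M0: "M0 t \<le> t\<^sup>2/2 - t^3/3 + t^4/12" .
  have "0 \<le> M0 t" using t by (auto simp: M0_def)
  then have "M0 t * norm (solve g) \<le> (t\<^sup>2/2 - t^3/3 + t^4/12) * ?H 0"
    using M0 norm_le by (intro mult_mono) auto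
  with w0 show ?thesis by (simp add: mult.commute)
qed

lemma solve_convex:
  assumes g: "continuous_on {0..1} g" and nonneg: "\<And>t. t \<in> {0..1} \<Longrightarrow> 0 \<le> g t"
  shows "convex_on {0..1} (app (solve g))"
proof (rule convex_on_01_if_deriv_mono[OF app_solve_deriv(1)[OF g]])
  show "mono_on {0..1} (prim (tail (tail g)))"
  proof (rule mono_onI)
    fix r s :: real assume rs: "r \<in> {0..1}" "s \<in> {0..1}" "r \<le> s"
    have tg: "0 \<le> tail g t" if "t \<in> {0..1}" for t by (rule tail_nonneg[OF g nonneg that])
    have "0 - 0 \<le> prim (tail (tail g)) s - prim (tail (tail g)) r"
      by (rule diff_le_if_deriv_le_01[of "\<lambda>_. 0" "\<lambda>_. 0", OF _ app_solve_deriv(2)[OF g]])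
        (use rs tail_nonneg[OF continuous_on_tail[OF g] tg] in auto)
    then show "prim (tail (tail g)) r \<le> prim (tail (tail g)) s" by simp
  qed
qed

section \<open>Cone, operator and energy\<close>

definition bcone :: "beam set" where
  "bcone = {x. app x \<in> K_cone}"

lemma bcone_iff:
  "x \<in> bcone \<longleftrightarrow> convex_on {0..1} (app x) \<and> (\<forall>t\<in>{0..1}. M0 t * norm x \<le> app x t)"
  by (simp add: bcone_def K_cone_def normX_app)

lemma M0_nonneg: "t \<in> {0..1} \<Longrightarrow> 0 \<le> M0 t"
  by (auto simp: M0_def)

lemma bcone_nonneg:
  assumes "x \<in> bcone" "t \<in> {0..1}"
  shows "0 \<le> app x t"
proof -
  have "0 \<le> M0 t * norm x" using M0_nonneg[OF assms(2)] by simp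
  also have "\<dots> \<le> app x t" using assms by (simp add: bcone_iff)
  finally show ?thesis .
qed

text \<open>For r \<le> s, the point r is a convex combination of 0 and s; convexity with u(0) = 0
  gives u(r) \<le> (r/s) u(s), and u(s) is nonnegative.\<close>

lemma bcone_mono:
  assumes x: "x \<in> bcone"
  shows "mono_on {0..1} (app x)"
proof (rule mono_onI)
  fix r s :: real assume rs: "r \<in> {0..1}" "s \<in> {0..1}" "r \<le> s"
  show "app x r \<le> app x s"
  proof (cases "s = 0")
    case False
    then have s: "0 < s" using rs by auto
    have cv: "convex_on {0..1} (app x)" using x by (simp add: bcone_iff)
    have "app x ((1 - r / s) *\<^sub>R 0 + (r / s) *\<^sub>R s) \<le> (1 - r / s) * app x 0 + r / s * app x s"
      by (rule convex_onD[OF cv]) (use rs s in auto)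
    then have "app x r \<le> r / s * app x s" using s by simp
    also have "\<dots> \<le> 1 * app x s"
      using rs s by (intro mult_right_mono bcone_nonneg[OF x]) auto
    finally show ?thesis by simp
  qed (use rs in auto)
qed

lemma bcone_lincomb:
  assumes x: "x \<in> bcone" and y: "y \<in> bcone" and ab: "0 \<le> a" "0 \<le> b"
  shows "a *\<^sub>R x + b *\<^sub>R y \<in> bcone"
  unfolding bcone_iff
proof (intro conjI ballI)
  have "app (a *\<^sub>R x + b *\<^sub>R y) = (\<lambda>t. a * app x t + b * app y t)" by auto
  moreover have "convex_on {0..1} (\<lambda>t. a * app x t + b * app y t)"
    using x y ab by (intro convex_on_add convex_on_cmul) (auto simp: bcone_iff)
  ultimately show "convex_on {0..1} (app (a *\<^sub>R x + b *\<^sub>R y))" by simp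
  fix t :: real assume t: "t \<in> {0..1}"
  have "M0 t * norm (a *\<^sub>R x + b *\<^sub>R y) \<le> M0 t * (a * norm x + b * norm y)"
    using norm_triangle_ineq[of "a *\<^sub>R x" "b *\<^sub>R y"] ab M0_nonneg[OF t] by (intro mult_left_mono) auto
  also have "\<dots> = a * (M0 t * norm x) + b * (M0 t * norm y)" by (simp add: algebra_simps)
  also have "\<dots> \<le> a * app x t + b * app y t"
    using x y t ab by (intro add_mono mult_left_mono) (auto simp: bcone_iff)
  finally show "M0 t * norm (a *\<^sub>R x + b *\<^sub>R y) \<le> app (a *\<^sub>R x + b *\<^sub>R y) t" by simp
qed

lemma bcone_scale: "x \<in> bcone \<Longrightarrow> 0 \<le> a \<Longrightarrow> a *\<^sub>R x \<in> bcone"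
  using bcone_lincomb[of x x a 0] by simp

lemma tendsto_app:
  assumes "(\<lambda>n. xs n) \<longlonglongrightarrow> x" "t \<in> {0..1}"
  shows "(\<lambda>n. app (xs n) t) \<longlonglongrightarrow> app x t"
proof (rule LIM_zero_cancel, rule Lim_null_comparison)
  show "\<forall>\<^sub>F n in sequentially. norm (app (xs n) t - app x t) \<le> norm (xs n - x)"
    using app_le_norm[OF assms(2), of "xs _ - x"] by simp
  show "(\<lambda>n. norm (xs n - x)) \<longlonglongrightarrow> 0"
    using assms(1) by (intro tendsto_norm_zero LIM_zero)
qed

text \<open>Norm convergence implies pointwise convergence, and both cone conditions are weak
  inequalities between point values and the norm.\<close>

lemma closed_cone: "closed bcone"
  unfolding closed_sequential_limits
proof (intro allI impI, elim conjE)
  fix xs x assume xs: "\<forall>n. xs n \<in> bcone" and lim: "xs \<longlonglongrightarrow> x"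
  note pt = tendsto_app[OF lim]
  show "x \<in> bcone"
    unfolding bcone_iff
  proof (intro conjI ballI)
    show "convex_on {0..1} (app x)"
    proof (rule convex_on_linorderI)
      fix t r s :: real assume t: "0 < t" "t < 1" and rs: "r \<in> {0..1}" "s \<in> {0..1}"
      have z: "(1 - t) *\<^sub>R r + t *\<^sub>R s \<in> {0..1}"
        using convexD_alt[of "{0..1::real}" r s t] t rs by simp
      show "app x ((1 - t) *\<^sub>R r + t *\<^sub>R s) \<le> (1 - t) * app x r + t * app x s"
      proof (rule LIMSEQ_le)
        show "(\<lambda>n. app (xs n) ((1 - t) *\<^sub>R r + t *\<^sub>R s)) \<longlonglongrightarrow> app x ((1 - t) *\<^sub>R r + t *\<^sub>R s)"
          by (rule pt[OF z])
        show "(\<lambda>n. (1 - t) * app (xs n) r + t * app (xs n) s) \<longlonglongrightarrow> (1 - t) * app x r + t * app x s"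
          by (intro tendsto_intros pt rs)
        have "app (xs n) ((1 - t) *\<^sub>R r + t *\<^sub>R s) \<le> (1 - t) * app (xs n) r + t * app (xs n) s" for n
          using xs t rs by (intro convex_onD) (auto simp: bcone_iff)
        then show "\<exists>N. \<forall>n\<ge>N. app (xs n) ((1 - t) *\<^sub>R r + t *\<^sub>R s) \<le> (1 - t) * app (xs n) r + t * app (xs n) s"
          by blast
      qed
    qed simp
    fix t :: real assume t: "t \<in> {0..1}"
    show "M0 t * norm x \<le> app x t"
      by (rule LIMSEQ_le[OF tendsto_mult_left[OF tendsto_norm[OF lim]] pt[OF t]])
        (use xs t in \<open>auto simp: bcone_iff\<close>)
  qed
qed

lemma solve_in_cone:
  assumes "continuous_on {0..1} g" "\<And>t. t \<in> {0..1} \<Longrightarrow> 0 \<le> g t" "mono_on {0..1} g"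
  shows "solve g \<in> bcone"
  using solve_convex[OF assms(1,2)] solve_Harnack[OF assms] by (auto simp: bcone_iff)

text \<open>Witnessed by \<open>t\<^sup>2 / 2\<close>.\<close>

lemma bcone_unit_exists: "\<exists>x\<in>bcone. norm x = 1"
proof
  let ?x = "beam_of (\<lambda>_. 1)"
  have c: "continuous_on {0..1} (\<lambda>_. 1::real)" by simp
  have L: "(\<lambda>_. 1) \<in> L2" by (rule L2_cont[OF c])
  have "(norm ?x)\<^sup>2 = 1" by (simp add: norm_beam_of[OF L])
  then show n: "norm ?x = 1" by (metis norm_ge_zero one_power2 power2_eq_imp_eq zero_le_one)
  have p: "prim (\<lambda>_. 1) t = t" if "t \<in> {0..1}" for t :: real
    using prim_eq_integral[OF integrable_U01_cont[OF c] that] that by simp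
  have der: "(app ?x has_real_derivative prim (\<lambda>_. 1) t) (at t within {0..1})" if "t \<in> {0..1}" for t
    using lift2_deriv[OF integrable_U01_cont[OF c] that] by (simp add: app_beam_of[OF L])
  show "?x \<in> bcone"
    unfolding bcone_iff
  proof (intro conjI ballI)
    show "convex_on {0..1} (app ?x)"
      by (rule convex_on_01_if_deriv_mono[OF der]) (auto simp: mono_on_def p)
    fix t :: real assume t: "t \<in> {0..1}"
    have "t\<^sup>2/2 - 0\<^sup>2/2 \<le> app ?x t - app ?x 0"
      by (rule diff_le_if_deriv_le_01[where f = "\<lambda>t. t\<^sup>2/2" and f' = "\<lambda>t. t", OF _ der])
        (use t p in \<open>auto intro!: derivative_eq_intros\<close>)
    moreover have "M0 t \<le> t\<^sup>2/2"
    proof -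
      have "sqrt 2 \<le> 3" by (rule real_le_lsqrt) auto
      moreover have "(1 - t) * t \<le> 1 * 1" using t by (intro mult_mono) auto
      ultimately have "sqrt 2 * ((1 - t) * t) \<le> 3 * 1" using t by (intro mult_mono) auto
      then have "sqrt 2 * ((1 - t) * t) * (t\<^sup>2 / 6) \<le> 3 * 1 * (t\<^sup>2 / 6)" by (intro mult_right_mono) auto
      then show ?thesis by (simp add: M0_def power2_eq_square power3_eq_cube algebra_simps)
    qed
    ultimately show "M0 t * norm ?x \<le> app ?x t" by (simp add: n)
  qed
qed

section \<open>The operator \<open>N\<close> on the cone and on the shell\<close>

locale cantilever =
  fixes f :: "real \<Rightarrow> real \<Rightarrow> real" and R0 R1 :: real
  assumes f_cont: "continuous_on ({0..1} \<times> UNIV) (\<lambda>(t, s). f t s)"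
    and f_nonneg: "\<And>t s. t \<in> {0..1} \<Longrightarrow> s \<ge> 0 \<Longrightarrow> f t s \<ge> 0"
    and f_mono_t: "\<And>s. s \<ge> 0 \<Longrightarrow> mono_on {0..1} (\<lambda>t. f t s)"
    and f_mono_s: "\<And>t. t \<in> {0..1} \<Longrightarrow> mono_on {0..} (f t)"
    and R0_R1: "0 < R0" "R0 < R1"
    and lower: "(LBINT t=ereal 0..ereal 1. M0 t * f t (M0 t * R0)) \<ge> R0"
    and upper: "(LBINT t=ereal 0..ereal 1. M1 t * f t (M1 t * R1)) \<le> R1"
begin

lemma f_le:
  "t \<in> {0..1} \<Longrightarrow> 0 \<le> r \<Longrightarrow> r \<le> s \<Longrightarrow> f t r \<le> f t s"
  using f_mono_s[of t] by (auto simp: mono_on_def)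

lemma continuous_on_f:
  assumes "continuous_on {0..1} u"
  shows "continuous_on {0..1} (\<lambda>t. f t (u t))"
proof -
  have "continuous_on {0..1} (\<lambda>t. (t, u t))"
    by (intro continuous_on_Pair continuous_on_id assms)
  from continuous_on_compose2[OF f_cont this] show ?thesis by auto
qed

lemma continuous_on_f_snd:
  assumes "t \<in> {0..1}"
  shows "continuous_on S (f t)"
proof -
  have "continuous_on S (\<lambda>s. (t, s))"
    by (intro continuous_on_Pair continuous_on_id continuous_on_const)
  moreover have "(\<lambda>s. (t, s)) ` S \<subseteq> {0..1} \<times> UNIV" using assms by auto
  ultimately have "continuous_on S (\<lambda>s. case (t, s) of (t, s) \<Rightarrow> f t s)"
    by (rule continuous_on_compose2[OF f_cont])
  then show ?thesis by simp
qed

definition N :: "beam \<Rightarrow> beam" where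
  "N x = solve (\<lambda>t. f t (app x t))"

lemma inner_N: "inner (N x) y = integral {0..1} (\<lambda>t. f t (app x t) * app y t)"
  unfolding N_def by (rule inner_solve[OF continuous_on_f[OF continuous_on_app]])

text \<open>The Harnack inequality needs a nondecreasing right-hand side. Elements of the cone are
  nondecreasing, so monotonicity of f in both variables makes t to f(t, u(t)) nondecreasing.\<close>

lemma N_cone:
  assumes x: "x \<in> bcone"
  shows "N x \<in> bcone"
  unfolding N_def
proof (rule solve_in_cone)
  show "continuous_on {0..1} (\<lambda>t. f t (app x t))" by (rule continuous_on_f[OF continuous_on_app])
  show "0 \<le> f t (app x t)" if "t \<in> {0..1}" for t
    by (rule f_nonneg[OF that bcone_nonneg[OF x that]])
  show "mono_on {0..1} (\<lambda>t. f t (app x t))"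
  proof (rule mono_onI)
    fix r s :: real assume rs: "r \<in> {0..1}" "s \<in> {0..1}" "r \<le> s"
    have "f r (app x r) \<le> f s (app x r)"
      using f_mono_t[OF bcone_nonneg[OF x rs(1)]] rs by (auto simp: mono_on_def)
    also have "\<dots> \<le> f s (app x s)"
      using bcone_mono[OF x] rs by (intro f_le bcone_nonneg[OF x]) (auto simp: mono_on_def)
    finally show "f r (app x r) \<le> f s (app x s)" .
  qed
qed

text \<open>The cone inequality enters twice: x \<ge> M0 R0 inside the monotone f, and y \<ge> M0
  |y| as the other factor, which reproduces the integrand of \<open>lower\<close>.\<close>

lemma inner_N_lower:
  assumes x: "x \<in> bcone" "R0 \<le> norm x" and y: "y \<in> bcone"
  shows "R0 * norm y \<le> inner (N x) y"
proof -
  have cM: "continuous_on {0..1} M0" unfolding M0_def by (intro continuous_intros) auto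
  have c: "continuous_on {0..1} (\<lambda>t. M0 t * f t (M0 t * R0))"
    by (intro continuous_on_mult cM continuous_on_f continuous_on_const)
  have "R0 * norm y \<le> integral {0..1} (\<lambda>t. M0 t * f t (M0 t * R0)) * norm y"
    using lower LBINT_eq_integral[OF c] by (intro mult_right_mono) auto
  also have "\<dots> = integral {0..1} (\<lambda>t. M0 t * f t (M0 t * R0) * norm y)"
    by simp
  also have "\<dots> \<le> integral {0..1} (\<lambda>t. f t (app x t) * app y t)"
  proof (rule integral_le)
    show "(\<lambda>t. M0 t * f t (M0 t * R0) * norm y) integrable_on {0..1}"
      by (intro integrable_continuous_interval continuous_on_mult c continuous_on_const)
    show "(\<lambda>t. f t (app x t) * app y t) integrable_on {0..1}"
      by (intro integrable_continuous_interval continuous_on_mult continuous_on_f continuous_on_app)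
    fix t :: real assume t: "t \<in> {0..1}"
    have "M0 t * R0 \<le> M0 t * norm x" using x M0_nonneg[OF t] by (intro mult_left_mono)
    also have "\<dots> \<le> app x t" using x t by (auto simp: bcone_iff)
    finally have le: "f t (M0 t * R0) \<le> f t (app x t)"
      using M0_nonneg[OF t] R0_R1 by (intro f_le t) auto
    have "f t (M0 t * R0) * (M0 t * norm y) \<le> f t (app x t) * app y t"
      using y t le M0_nonneg[OF t] R0_R1
      by (intro mult_mono) (auto simp: bcone_iff intro!: f_nonneg bcone_nonneg x)
    then show "M0 t * f t (M0 t * R0) * norm y \<le> f t (app x t) * app y t"
      by (simp add: mult_ac)
  qed
  finally show ?thesis by (simp add: inner_N)
qed

lemma inner_N_upper:
  assumes x: "x \<in> bcone" "norm x \<le> R1" and y: "y \<in> bcone"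
  shows "inner (N x) y \<le> R1 * norm y"
proof -
  have c: "continuous_on {0..1} (\<lambda>t. M1 t * f t (M1 t * R1))"
    by (intro continuous_on_mult continuous_on_M1 continuous_on_f continuous_on_const)
  have "inner (N x) y = integral {0..1} (\<lambda>t. f t (app x t) * app y t)" by (rule inner_N)
  also have "\<dots> \<le> integral {0..1} (\<lambda>t. M1 t * f t (M1 t * R1) * norm y)"
  proof (rule integral_le)
    show "(\<lambda>t. M1 t * f t (M1 t * R1) * norm y) integrable_on {0..1}"
      by (intro integrable_continuous_interval continuous_on_mult c continuous_on_const)
    show "(\<lambda>t. f t (app x t) * app y t) integrable_on {0..1}"
      by (intro integrable_continuous_interval continuous_on_mult continuous_on_f continuous_on_app)
    fix t :: real assume t: "t \<in> {0..1}"
    have "app x t \<le> M1 t * norm x" using app_le_M1[OF t, of x] by linarith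
    also have "\<dots> \<le> M1 t * R1" using x M1_bounds[OF t] by (intro mult_left_mono) auto
    finally have le: "f t (app x t) \<le> f t (M1 t * R1)"
      by (intro f_le t bcone_nonneg[OF x(1)])
    have "f t (app x t) * app y t \<le> f t (M1 t * R1) * (M1 t * norm y)"
      using app_le_M1[OF t, of y] le M1_bounds[OF t] R0_R1 t
      by (intro mult_mono) (auto intro!: f_nonneg bcone_nonneg x y)
    then show "f t (app x t) * app y t \<le> M1 t * f t (M1 t * R1) * norm y"
      by (simp add: mult_ac)
  qed
  also have "\<dots> = integral {0..1} (\<lambda>t. M1 t * f t (M1 t * R1)) * norm y" by simp
  also have "\<dots> \<le> R1 * norm y"
    using upper LBINT_eq_integral[OF c] by (intro mult_right_mono) auto
  finally show ?thesis .
qed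

definition Sh :: "beam set" where
  "Sh = {x \<in> bcone. R0 \<le> norm x \<and> norm x \<le> R1}"

lemma ShD: "x \<in> Sh \<Longrightarrow> x \<in> bcone" "x \<in> Sh \<Longrightarrow> R0 \<le> norm x" "x \<in> Sh \<Longrightarrow> norm x \<le> R1"
  by (auto simp: Sh_def)

lemma closed_Sh: "closed Sh"
proof -
  have "Sh = bcone \<inter> {x. R0 \<le> norm x} \<inter> {x. norm x \<le> R1}" by (auto simp: Sh_def)
  then show ?thesis
    by (auto intro!: closed_Int closed_cone closed_Collect_le continuous_intros)
qed

lemma shell_eq: "shell R0 R1 = app ` Sh"
proof -
  have "u \<in> app ` Sh" if "u \<in> shell R0 R1" for u
  proof -
    have "u \<in> X" using that by (simp add: shell_def K_cone_def)
    then have "app (Abs_beam u) = u" by (simp add: app.rep_eq Abs_beam_inverse)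
    then show ?thesis
      using that by (intro image_eqI[of _ _ "Abs_beam u"]) (auto simp: shell_def Sh_def bcone_def normX_app[symmetric])
  qed
  then show ?thesis by (auto simp: shell_def Sh_def bcone_def normX_app)
qed

text \<open>The lower estimate is tested with x and the upper one with \<open>N x\<close>; in each
  case one norm cancels.\<close>

lemma N_Sh:
  assumes x: "x \<in> Sh"
  shows "N x \<in> Sh"
proof -
  note xD = ShD[OF x]
  have "R0 * norm x \<le> norm (N x) * norm x"
    using inner_N_lower[OF xD(1,2,1)] norm_cauchy_schwarz[of "N x" x] by linarith
  then have "R0 \<le> norm (N x)" using xD(2) R0_R1 by (auto simp: mult_le_cancel_right)
  moreover have "norm (N x) * norm (N x) \<le> R1 * norm (N x)"
    using inner_N_upper[OF xD(1,3) N_cone[OF xD(1)]] by (simp add: power2_norm_eq_inner[symmetric] power2_eq_square)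
  ultimately show ?thesis
    using N_cone[OF xD(1)] R0_R1 by (auto simp: Sh_def mult_le_cancel_right)
qed

text \<open>The inner product of the new point with x is at least R0 |x|, so Cauchy-Schwarz gives
  the lower norm bound; the triangle inequality gives the upper one.\<close>

lemma segment_Sh:
  assumes x: "x \<in> Sh" and h: "0 \<le> h" "h \<le> 1"
  shows "(1 - h) *\<^sub>R x + h *\<^sub>R N x \<in> Sh"
proof -
  let ?w = "(1 - h) *\<^sub>R x + h *\<^sub>R N x"
  note xD = ShD[OF x] and ND = ShD[OF N_Sh[OF x]]
  have "R0 * norm x = (1 - h) * (R0 * norm x) + h * (R0 * norm x)" by (simp add: algebra_simps)
  also have "\<dots> \<le> (1 - h) * (norm x * norm x) + h * inner (N x) x"
    using h xD(2) inner_N_lower[OF xD(1,2,1)] by (intro add_mono mult_left_mono mult_right_mono) auto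
  also have "\<dots> = inner ?w x"
    by (simp add: inner_add_left power2_norm_eq_inner[symmetric] power2_eq_square)
  also have "\<dots> \<le> norm ?w * norm x" by (rule norm_cauchy_schwarz)
  finally have "R0 \<le> norm ?w" using xD(2) R0_R1 by (auto simp: mult_le_cancel_right)
  moreover have "norm ?w \<le> (1 - h) * norm x + h * norm (N x)"
    using norm_triangle_ineq[of "(1 - h) *\<^sub>R x" "h *\<^sub>R N x"] h by simp
  moreover have "\<dots> \<le> (1 - h) * R1 + h * R1"
    using h xD ND by (intro add_mono mult_left_mono) auto
  moreover have "\<dots> = R1" by (simp add: algebra_simps)
  ultimately have "R0 \<le> norm ?w" "norm ?w \<le> R1" by linarith+
  then show ?thesis
    using bcone_lincomb[OF xD(1) ND(1), of "1 - h" h] h unfolding Sh_def by simp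
qed

section \<open>Convexity of the potential and descent of the energy\<close>

lemma F_eq_integral:
  assumes "t \<in> {0..1}" "0 \<le> s"
  shows "F f t s = integral {0..s} (f t)"
  unfolding F_def by (rule LBINT_eq_integral[OF continuous_on_f_snd[OF assms(1)] assms(2)])

lemma F_diff:
  assumes t: "t \<in> {0..1}" and ab: "0 \<le> a" "a \<le> b"
  shows "f t a * (b - a) \<le> F f t b - F f t a" "F f t b - F f t a \<le> f t b * (b - a)"
proof -
  have int: "f t integrable_on {c..d}" for c d
    by (intro integrable_continuous_interval continuous_on_f_snd t)
  have eq: "F f t b - F f t a = integral {a..b} (f t)"
    using Henstock_Kurzweil_Integration.integral_combine[of 0 a b "f t", OF _ _ int] ab
      F_eq_integral[OF t, of a] F_eq_integral[OF t, of b] by simp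
  have "integral {a..b} (\<lambda>_. f t a) \<le> integral {a..b} (f t)"
    by (rule integral_le) (use ab t int in \<open>auto intro!: f_le\<close>)
  then show "f t a * (b - a) \<le> F f t b - F f t a" using ab by (simp add: eq mult.commute)
  have "integral {a..b} (f t) \<le> integral {a..b} (\<lambda>_. f t b)"
    by (rule integral_le) (use ab t int in \<open>auto intro!: f_le\<close>)
  then show "F f t b - F f t a \<le> f t b * (b - a)" using ab by (simp add: eq mult.commute)
qed

lemma F_convex:
  assumes t: "t \<in> {0..1}" and ab: "0 \<le> a" "0 \<le> b"
  shows "f t a * (b - a) \<le> F f t b - F f t a"
proof (cases "a \<le> b")
  case False
  then have "F f t a - F f t b \<le> f t a * (a - b)" using F_diff(2)[OF t ab(2)] by simp
  then show ?thesis by (simp add: algebra_simps)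
qed (use F_diff[OF t ab(1)] in simp)

text \<open>A Lipschitz bound in the second variable that is uniform in t is combined with
  continuity in t at a fixed second argument. By monotonicity f is largest at (1, B), hence the
  Lipschitz constant \<open>f 1 B\<close>.\<close>

lemma continuous_on_F:
  assumes u: "continuous_on {0..1} u" and nonneg: "\<And>t. t \<in> {0..1} \<Longrightarrow> 0 \<le> u t"
  shows "continuous_on {0..1} (\<lambda>t. F f t (u t))"
proof -
  obtain B where B: "B > 0" "\<And>t. t \<in> {0..1} \<Longrightarrow> \<bar>u t\<bar> \<le> B"
    using continuous_bounded_01[OF u] by blast
  have Lip: "\<bar>F f t a - F f t b\<bar> \<le> f 1 B * \<bar>a - b\<bar>"
    if t: "t \<in> {0..1}" and ab: "0 \<le> a" "a \<le> B" "0 \<le> b" "b \<le> B" for t a b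
  proof -
    have f_le_B: "f t r \<le> f 1 B" if "0 \<le> r" "r \<le> B" for r
    proof -
      have "f t r \<le> f t B" by (rule f_le[OF t that])
      also have "\<dots> \<le> f 1 B" using f_mono_t[of B] t B(1) by (auto simp: mono_on_def)
      finally show ?thesis .
    qed
    have *: "\<bar>F f t b - F f t a\<bar> \<le> f 1 B * \<bar>a - b\<bar>"
      if "0 \<le> a" "a \<le> b" "b \<le> B" for a b
    proof -
      have "0 \<le> f t a * (b - a)" using f_nonneg[OF t that(1)] that by simp
      moreover have "f t b * (b - a) \<le> f 1 B * (b - a)" using that by (intro mult_right_mono f_le_B) auto
      ultimately show ?thesis using F_diff[OF t that(1,2)] that by simp
    qed
    show ?thesis
    proof (cases "a \<le> b")
      case True
      then show ?thesis using *[of a b] ab by (simp add: abs_minus_commute)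
    next
      case False
      then show ?thesis using *[of b a] ab by (simp add: abs_minus_commute)
    qed
  qed
  have F_t: "continuous_on {0..1} (\<lambda>t. F f t s)" if s: "0 \<le> s" for s
  proof -
    have "continuous_on {0..1} (\<lambda>t. integral (cbox 0 s) (f t))"
      by (rule integral_continuous_on_param) (rule continuous_on_subset[OF f_cont], auto)
    then show ?thesis
      by (rule continuous_on_eq) (simp add: F_eq_integral s)
  qed
  show ?thesis
    unfolding continuous_on_def
  proof
    fix t0 :: real assume t0: "t0 \<in> {0..1}"
    let ?A = "at t0 within {0..1}"
    show "((\<lambda>t. F f t (u t)) \<longlongrightarrow> F f t0 (u t0)) ?A"
    proof (rule LIM_zero_cancel, rule Lim_null_comparison)
      show "\<forall>\<^sub>F t in ?A. norm (F f t (u t) - F f t0 (u t0)) \<le>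
          f 1 B * \<bar>u t - u t0\<bar> + \<bar>F f t (u t0) - F f t0 (u t0)\<bar>"
        unfolding eventually_at_filter
      proof (intro always_eventually allI impI)
        fix t :: real assume t: "t \<in> {0..1}"
        have "\<bar>F f t (u t) - F f t (u t0)\<bar> \<le> f 1 B * \<bar>u t - u t0\<bar>"
          using Lip[OF t, of "u t" "u t0"] nonneg[OF t] nonneg[OF t0] B(2)[OF t] B(2)[OF t0] by simp
        then show "norm (F f t (u t) - F f t0 (u t0)) \<le>
            f 1 B * \<bar>u t - u t0\<bar> + \<bar>F f t (u t0) - F f t0 (u t0)\<bar>" by simp
      qed
      have "((\<lambda>t. f 1 B * \<bar>u t - u t0\<bar> + \<bar>F f t (u t0) - F f t0 (u t0)\<bar>) \<longlongrightarrow>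
          f 1 B * \<bar>u t0 - u t0\<bar> + \<bar>F f t0 (u t0) - F f t0 (u t0)\<bar>) ?A"
        using u F_t[OF nonneg[OF t0]] t0 by (intro tendsto_intros) (auto simp: continuous_on_def)
      then show "((\<lambda>t. f 1 B * \<bar>u t - u t0\<bar> + \<bar>F f t (u t0) - F f t0 (u t0)\<bar>) \<longlongrightarrow> 0) ?A"
        by simp
    qed
  qed
qed

definition Phi :: "beam \<Rightarrow> real" where
  "Phi x = integral {0..1} (\<lambda>t. F f t (app x t))"

definition E :: "beam \<Rightarrow> real" where
  "E x = (norm x)\<^sup>2 / 2 - Phi x"

lemma energy_app:
  assumes "x \<in> bcone"
  shows "energy f (app x) = E x"
  unfolding energy_def E_def Phi_def normX_app
  by (subst LBINT_eq_integral) (auto intro!: continuous_on_F continuous_on_app bcone_nonneg assms)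

text \<open>Integrating the tangent inequality of F(t, .) shows that \<open>N x\<close> acts as a
  subgradient of \<open>Phi\<close> at x within the cone.\<close>

lemma Phi_convex:
  assumes x: "x \<in> bcone" and y: "y \<in> bcone"
  shows "inner (N x) (y - x) \<le> Phi y - Phi x"
proof -
  have c: "continuous_on {0..1} (\<lambda>t. F f t (app z t))" if "z \<in> bcone" for z
    by (intro continuous_on_F continuous_on_app bcone_nonneg that)
  have "inner (N x) (y - x) = integral {0..1} (\<lambda>t. f t (app x t) * app (y - x) t)"
    by (rule inner_N)
  also have "\<dots> \<le> integral {0..1} (\<lambda>t. F f t (app y t) - F f t (app x t))"
  proof (rule integral_le)
    show "(\<lambda>t. f t (app x t) * app (y - x) t) integrable_on {0..1}"
      by (intro integrable_continuous_interval continuous_on_mult continuous_on_f continuous_on_app)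
    show "(\<lambda>t. F f t (app y t) - F f t (app x t)) integrable_on {0..1}"
      by (intro integrable_continuous_interval continuous_on_diff c x y)
  qed (use F_convex bcone_nonneg x y in auto)
  also have "\<dots> = Phi y - Phi x"
    unfolding Phi_def
    by (intro Henstock_Kurzweil_Integration.integral_diff integrable_continuous_interval c x y)
  finally show ?thesis .
qed

text \<open>On the shell the subgradients \<open>N x\<close> have norm at most R1; the subgradient
  inequality is used from both ends.\<close>

lemma Phi_Lipschitz:
  assumes x: "x \<in> Sh" and y: "y \<in> Sh"
  shows "\<bar>Phi x - Phi y\<bar> \<le> R1 * norm (x - y)"
proof -
  have *: "- (R1 * norm (y - x)) \<le> Phi y - Phi x" if "x \<in> Sh" "y \<in> Sh" for x y
  proof -
    have "\<bar>inner (N x) (y - x)\<bar> \<le> norm (N x) * norm (y - x)" by (rule Cauchy_Schwarz_ineq2)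
    also have "\<dots> \<le> R1 * norm (y - x)" using ShD[OF N_Sh[OF that(1)]] by (intro mult_right_mono) auto
    finally show ?thesis using Phi_convex[OF ShD(1)[OF that(1)] ShD(1)[OF that(2)]] by linarith
  qed
  from *[OF x y] *[OF y x] show ?thesis by (simp add: norm_minus_commute)
qed

lemma continuous_on_E: "continuous_on Sh E"
proof -
  have "R1-lipschitz_on Sh Phi"
    by (rule lipschitz_onI) (use Phi_Lipschitz R0_R1 in \<open>auto simp: dist_norm\<close>)
  then have "continuous_on Sh Phi" by (rule lipschitz_on_continuous_on)
  then show ?thesis unfolding E_def by (intro continuous_intros) auto
qed

text \<open>With d = N x - x the quadratic part expands exactly, and \<open>Phi\<close> is bounded
  below at the new point by its tangent at x. The terms with (x, d) cancel, leaving -(h - h^2/2)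
  |d|^2.\<close>

lemma E_descent:
  assumes x: "x \<in> bcone" and h: "0 \<le> h" "h \<le> 1"
  shows "E ((1 - h) *\<^sub>R x + h *\<^sub>R N x) \<le> E x - (h - h\<^sup>2 / 2) * (norm (x - N x))\<^sup>2"
proof -
  define d where "d = N x - x"
  have w: "(1 - h) *\<^sub>R x + h *\<^sub>R N x = x + h *\<^sub>R d" by (simp add: d_def algebra_simps)
  have Nx: "N x = x + d" by (simp add: d_def)
  have "x + h *\<^sub>R d \<in> bcone"
    using bcone_lincomb[OF x N_cone[OF x], of "1 - h" h] h by (simp add: w)
  from Phi_convex[OF x this] have "h * inner (N x) d \<le> Phi (x + h *\<^sub>R d) - Phi x" by simp
  moreover have "inner (N x) d = inner x d + (norm d)\<^sup>2"
    by (simp add: Nx inner_add_left power2_norm_eq_inner)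
  moreover have "(norm (x + h *\<^sub>R d))\<^sup>2 = (norm x)\<^sup>2 + 2 * h * inner x d + h\<^sup>2 * (norm d)\<^sup>2"
    unfolding power2_norm_eq_inner
    by (simp add: inner_add_left inner_add_right inner_commute[of d x] power2_eq_square algebra_simps)
  moreover have "norm (x - N x) = norm d" by (simp add: d_def norm_minus_commute)
  ultimately show ?thesis unfolding w E_def by (simp add: algebra_simps add_divide_distrib)
qed

lemma E_N:
  assumes "x \<in> bcone"
  shows "E (N x) \<le> E x - (norm (x - N x))\<^sup>2 / 2"
  using E_descent[OF assms, of 1] by simp

lemma f_uniformly_continuous:
  assumes "0 < e"
  obtains d where "0 < d"
    "\<And>t a b. t \<in> {0..1} \<Longrightarrow> \<bar>a\<bar> \<le> B \<Longrightarrow> \<bar>b\<bar> \<le> B \<Longrightarrow> \<bar>a - b\<bar> < d \<Longrightarrow> \<bar>f t a - f t b\<bar> < e"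
proof -
  have "uniformly_continuous_on ({0..1} \<times> {-B..B}) (\<lambda>(t, s). f t s)"
    by (intro compact_uniformly_continuous continuous_on_subset[OF f_cont] compact_Times) auto
  then obtain d where "0 < d" and d: "\<And>p q. p \<in> {0..1} \<times> {-B..B} \<Longrightarrow> q \<in> {0..1} \<times> {-B..B} \<Longrightarrow>
      dist q p < d \<Longrightarrow> dist (case q of (t, s) \<Rightarrow> f t s) (case p of (t, s) \<Rightarrow> f t s) < e"
    using assms unfolding uniformly_continuous_on_def by metis
  show ?thesis
  proof (rule that[OF \<open>0 < d\<close>])
    fix t a b :: real assume "t \<in> {0..1}" "\<bar>a\<bar> \<le> B" "\<bar>b\<bar> \<le> B" "\<bar>a - b\<bar> < d"
    then show "\<bar>f t a - f t b\<bar> < e"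
      using d[of "(t, b)" "(t, a)"] by (auto simp: dist_Pair_Pair dist_real_def abs_le_iff)
  qed
qed

lemma continuous_on_N: "continuous_on Sh N"
  unfolding continuous_on_iff
proof (intro ballI allI impI)
  fix x and e :: real assume x: "x \<in> Sh" and e: "0 < e"
  obtain d where d: "0 < d"
    "\<And>t a b. t \<in> {0..1} \<Longrightarrow> \<bar>a\<bar> \<le> R1 \<Longrightarrow> \<bar>b\<bar> \<le> R1 \<Longrightarrow> \<bar>a - b\<bar> < d \<Longrightarrow> \<bar>f t a - f t b\<bar> < e / 2"
    using f_uniformly_continuous[of "e / 2" R1] e by auto
  have "dist (N y) (N x) < e" if y: "y \<in> Sh" and yx: "dist y x < d" for y
  proof -
    have "norm (N y - N x) \<le> e / 2"
      unfolding N_def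
    proof (rule norm_solve_diff_le)
      fix t :: real assume t: "t \<in> {0..1}"
      have "\<bar>app y t - app x t\<bar> < d"
        using app_le_norm[OF t, of "y - x"] yx by (simp add: dist_norm)
      moreover have "\<bar>app y t\<bar> \<le> R1" "\<bar>app x t\<bar> \<le> R1"
        using app_le_norm[OF t] ShD(3)[OF x] ShD(3)[OF y] by (meson order_trans)+
      ultimately show "\<bar>f t (app y t) - f t (app x t)\<bar> \<le> e / 2"
        using d(2)[OF t] by (intro less_imp_le)
    qed (intro continuous_on_f continuous_on_app)+
    then show ?thesis using e by (simp add: dist_norm)
  qed
  then show "\<exists>d>0. \<forall>x'\<in>Sh. dist x' x < d \<longrightarrow> dist (N x') (N x) < e" using d(1) by blast
qed

end

section \<open>Critical points\<close>

text \<open>Used with a n = |x_n - N x_n| and b n = E(x_n), where the hypothesis combines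
  \<open>E_N\<close> with E(N x_n) \<ge> c.\<close>

lemma tendsto_zero_if_square_le_gap:
  fixes a b :: "nat \<Rightarrow> real"
  assumes le: "\<And>n. (a n)\<^sup>2 \<le> 2 * (b n - c)" and "b \<longlonglongrightarrow> c"
  shows "a \<longlonglongrightarrow> 0"
proof -
  have "(\<lambda>n. 2 * (b n - c)) \<longlonglongrightarrow> 2 * (c - c)" by (intro tendsto_intros assms)
  then have "(\<lambda>n. 2 * (b n - c)) \<longlonglongrightarrow> 0" by simp
  then have "(\<lambda>n. (a n)\<^sup>2) \<longlonglongrightarrow> 0"
    by (rule Lim_null_comparison[rotated]) (use le in simp)
  from tendsto_real_sqrt[OF this] show ?thesis by (simp add: tendsto_rabs_zero_iff)
qed

context cantilever
begin

text \<open>The convergent subsequence exists because \<open>N\<close> factors through the compact embedding into \<open>C[0,1]\<close>.\<close>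

lemma Palais_Smale:
  assumes xs: "\<And>n. xs n \<in> Sh" and small: "(\<lambda>n. norm (xs n - N (xs n))) \<longlonglongrightarrow> 0"
    and E_lim: "(\<lambda>n. E (xs n)) \<longlonglongrightarrow> e"
  obtains v where "v \<in> Sh" "N v = v" "E v = e"
proof -
  have bound: "\<bar>app (xs n) t\<bar> \<le> R1" if "t \<in> {0..1}" for n t
    using app_le_norm[OF that, of "xs n"] ShD(3)[OF xs, of n] by linarith
  have equicont: "\<exists>d>0. \<forall>n y. y \<in> {0..1} \<and> norm (t - y) < d \<longrightarrow> norm (app (xs n) t - app (xs n) y) < e"
    if t: "t \<in> {0..1}" and e: "0 < e" for t e
  proof (intro exI conjI allI impI)
    show "0 < e / R1" using e R0_R1 by simp
    fix n y assume y: "y \<in> {0..1} \<and> norm (t - y) < e / R1"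
    have "\<bar>app (xs n) t - app (xs n) y\<bar> \<le> norm (xs n) * \<bar>t - y\<bar>"
      by (rule app_Lipschitz[OF t]) (use y in simp)
    also have "\<dots> \<le> R1 * \<bar>t - y\<bar>" using ShD(3)[OF xs] by (intro mult_right_mono) auto
    also have "\<dots> < e" using y R0_R1 by (simp add: field_simps)
    finally show "norm (app (xs n) t - app (xs n) y) < e" by simp
  qed
  obtain g k where g: "continuous_on {0..1} g" and k: "strict_mono (k :: nat \<Rightarrow> nat)"
    and unif: "\<And>e. 0 < e \<Longrightarrow> \<exists>M. \<forall>n t. n \<ge> M \<and> t \<in> {0..1} \<longrightarrow> norm (app (xs (k n)) t - g t) < e"
  proof (rule Arzela_Ascoli[of "{0..1}" "\<lambda>n. app (xs n)" R1, OF compact_Icc bound[folded real_norm_def] equicont])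
    fix g k assume "continuous_on {0..1} g" "strict_mono (k :: nat \<Rightarrow> nat)"
      "\<And>e. 0 < e \<Longrightarrow> \<exists>M. \<forall>n t. n \<ge> M \<and> t \<in> {0..1} \<longrightarrow> norm (app (xs (k n)) t - g t) < e"
    then show thesis by (rule that)
  qed
  have pt: "(\<lambda>n. app (xs (k n)) t) \<longlonglongrightarrow> g t" if "t \<in> {0..1}" for t
  proof (rule LIMSEQ_I)
    fix e :: real assume "0 < e"
    from unif[OF this] that show "\<exists>M. \<forall>n\<ge>M. norm (app (xs (k n)) t - g t) < e" by meson
  qed
  have g_bound: "\<bar>g t\<bar> \<le> R1" if "t \<in> {0..1}" for t
    by (rule LIMSEQ_le_const2[OF tendsto_rabs[OF pt[OF that]]]) (use bound that in auto)
  \<comment> \<open>The uniform limit g is only known to be continuous, so \<open>N\<close> cannot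
    be applied to it; the candidate limit is obtained by solving with g directly.\<close>
  define v where "v = solve (\<lambda>t. f t (g t))"
  have "(\<lambda>n. N (xs (k n))) \<longlonglongrightarrow> v"
    unfolding LIMSEQ_iff
  proof (intro allI impI)
    fix e :: real assume e: "0 < e"
    obtain d where d: "0 < d"
      "\<And>t a b. t \<in> {0..1} \<Longrightarrow> \<bar>a\<bar> \<le> R1 \<Longrightarrow> \<bar>b\<bar> \<le> R1 \<Longrightarrow> \<bar>a - b\<bar> < d \<Longrightarrow> \<bar>f t a - f t b\<bar> < e / 2"
      using f_uniformly_continuous[of "e / 2" R1] e by auto
    obtain M where M: "\<And>n t. n \<ge> M \<Longrightarrow> t \<in> {0..1} \<Longrightarrow> norm (app (xs (k n)) t - g t) < d"
      using unif[OF d(1)] by blast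
    have "norm (N (xs (k n)) - v) < e" if n: "n \<ge> M" for n
    proof -
      have "norm (N (xs (k n)) - v) \<le> e / 2"
        unfolding N_def v_def
      proof (rule norm_solve_diff_le)
        fix t :: real assume t: "t \<in> {0..1}"
        show "\<bar>f t (app (xs (k n)) t) - f t (g t)\<bar> \<le> e / 2"
          by (rule less_imp_le, rule d(2)[OF t bound[OF t] g_bound[OF t]]) (use M[OF n t] in simp)
      qed (intro continuous_on_f continuous_on_app g)+
      then show ?thesis using e by simp
    qed
    then show "\<exists>M. \<forall>n\<ge>M. norm (N (xs (k n)) - v) < e" by blast
  qed
  moreover have "(\<lambda>n. xs (k n) - N (xs (k n))) \<longlonglongrightarrow> 0"
    by (rule tendsto_norm_zero_cancel) (use LIMSEQ_subseq_LIMSEQ[OF small k] in \<open>simp add: o_def\<close>)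
  ultimately have lim: "(\<lambda>n. xs (k n)) \<longlonglongrightarrow> v"
    using tendsto_add[of "\<lambda>n. xs (k n) - N (xs (k n))" 0 sequentially "\<lambda>n. N (xs (k n))" v] by simp
  have v: "v \<in> Sh"
    by (rule closed_sequentially[OF closed_Sh _ lim]) (use xs in auto)
  \<comment> \<open>Only now is g identified with an element of the shell, so the definition of v
    becomes the equation N v = v.\<close>
  have "g t = app v t" if "t \<in> {0..1}" for t
    by (rule LIMSEQ_unique[OF pt[OF that] tendsto_app[OF lim that]])
  then have "norm (N v - v) \<le> 0"
    unfolding N_def by (subst (2) v_def) (intro norm_solve_diff_le continuous_on_f continuous_on_app g, simp)
  then have "N v = v" by simp
  moreover have "(\<lambda>n. E (xs (k n))) \<longlonglongrightarrow> E v"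
    by (rule continuous_on_tendsto_compose[OF continuous_on_E lim v]) (use xs in auto)
  moreover have "(\<lambda>n. E (xs (k n))) \<longlonglongrightarrow> e"
    using LIMSEQ_subseq_LIMSEQ[OF E_lim k] by (simp add: o_def)
  ultimately have "N v = v" "E v = e" by (auto intro: LIMSEQ_unique)
  then show ?thesis by (rule that[OF v])
qed

text \<open>\<open>M0\<close> vanishes at 0 and 1, so positivity is read off at an interior
  point.\<close>

lemma app_half_pos:
  assumes "v \<in> Sh"
  shows "0 < app v (1/2)"
proof -
  have "0 < norm v" using ShD(2)[OF assms] R0_R1 by linarith
  then have "0 < M0 (1/2) * norm v" by (intro mult_pos_pos) (simp_all add: M0_def)
  also have "\<dots> \<le> app v (1/2)" using ShD(1)[OF assms] by (simp add: bcone_iff)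
  finally show ?thesis .
qed

text \<open>The equation N v = v presents v, a priori only in H^2, as \<open>solve\<close> of a
  continuous function, which provides the four derivatives and the conditions at 1.\<close>

lemma fixed_point_positive:
  assumes v: "v \<in> Sh" and fp: "N v = v"
  shows "positive_solution f (app v)"
  unfolding positive_solution_def
proof (intro conjI ballI)
  have "solution f (app (solve (\<lambda>t. f t (app v t))))"
    by (rule solution_solve[OF continuous_on_f[OF continuous_on_app]]) (simp add: fp[unfolded N_def])
  then show "solution f (app v)" by (simp add: fp[unfolded N_def])
  show "0 \<le> app v t" if "t \<in> {0..1}" for t by (rule bcone_nonneg[OF ShD(1)[OF v] that])
  show "\<exists>t\<in>{0..1}. app v t \<noteq> 0"
    using app_half_pos[OF v] by (intro bexI[of _ "1/2"]) auto
qed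

lemma minimiser:
  obtains v where "v \<in> Sh" "N v = v" "\<forall>x\<in>Sh. E v \<le> E x"
proof -
  obtain z where z: "z \<in> bcone" "norm z = 1"
    using bcone_unit_exists by blast
  then have "norm (R0 *\<^sub>R z) = R0" "R0 *\<^sub>R z \<in> bcone" using R0_R1 by (simp_all add: bcone_scale)
  then have z': "R0 *\<^sub>R z \<in> Sh" using R0_R1 unfolding Sh_def by simp
  \<comment> \<open>Points of the shell are at most 2 R1 apart, so the Lipschitz bound relative to
    one fixed point keeps \<open>Phi\<close> bounded above.\<close>
  have "- (Phi (R0 *\<^sub>R z) + R1 * (R1 + R1)) \<le> E x" if x: "x \<in> Sh" for x
  proof -
    have "norm (x - R0 *\<^sub>R z) \<le> R1 + R1"
      using norm_triangle_ineq4[of x "R0 *\<^sub>R z"] ShD(3)[OF x] ShD(3)[OF z'] by linarith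
    then have "R1 * norm (x - R0 *\<^sub>R z) \<le> R1 * (R1 + R1)" using R0_R1 by (intro mult_left_mono) auto
    then have "Phi x - Phi (R0 *\<^sub>R z) \<le> R1 * (R1 + R1)" using Phi_Lipschitz[OF x z'] by linarith
    moreover have "0 \<le> (norm x)\<^sup>2 / 2" by simp
    ultimately show ?thesis unfolding E_def by linarith
  qed
  then have bdd: "bdd_below (E ` Sh)" by (rule bdd_belowI2)
  define m where "m = Inf (E ` Sh)"
  have m_le: "m \<le> E x" if "x \<in> Sh" for x
    unfolding m_def by (rule cInf_lower[OF imageI[OF that] bdd])
  have "\<exists>x\<in>Sh. E x < m + inverse (real (Suc n))" for n
  proof -
    have "Inf (E ` Sh) < m + inverse (real (Suc n))" by (simp add: m_def)
    moreover have "E ` Sh \<noteq> {}" using z' by blast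
    ultimately show ?thesis using cInf_lessD by (metis imageE)
  qed
  then obtain xs where xs: "\<And>n. xs n \<in> Sh" and xs_E: "\<And>n. E (xs n) < m + inverse (real (Suc n))"
    by metis
  have lim_m: "(\<lambda>n. m + inverse (real (Suc n))) \<longlonglongrightarrow> m"
    using tendsto_add[OF tendsto_const LIMSEQ_inverse_real_of_nat, of m] by simp
  have E_lim: "(\<lambda>n. E (xs n)) \<longlonglongrightarrow> m"
    by (rule tendsto_sandwich[OF _ _ tendsto_const lim_m])
      (intro always_eventually allI m_le xs less_imp_le[OF xs_E])+
  \<comment> \<open>The full step h = 1 stays in the shell, so it cannot bring the energy below
    m.\<close>
  have "(norm (xs n - N (xs n)))\<^sup>2 \<le> 2 * (E (xs n) - m)" for n
    using E_N[OF ShD(1)[OF xs], of n] m_le[OF N_Sh[OF xs], of n] by simp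
  from tendsto_zero_if_square_le_gap[OF this E_lim]
  have small: "(\<lambda>n. norm (xs n - N (xs n))) \<longlonglongrightarrow> 0" .
  obtain v where v: "v \<in> Sh" "N v = v" "E v = m"
    by (rule Palais_Smale[OF xs small E_lim])
  show ?thesis by (rule that[OF v(1,2)]) (simp add: v(3) m_le)
qed

text \<open>A straight segment may dip inside the inner sphere; where it does, the point is scaled
  radially out to norm R0, which preserves the cone. The path makes the minimax level finite from
  above.\<close>

definition segment_path :: "beam \<Rightarrow> beam \<Rightarrow> real \<Rightarrow> beam" where
  "segment_path x y s =
     (let w = (1 - s) *\<^sub>R x + s *\<^sub>R y in max 1 (R0 / norm w) *\<^sub>R w)"

definition beam_paths :: "beam \<Rightarrow> beam \<Rightarrow> (real \<Rightarrow> beam) set" where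
  "beam_paths x y = {\<gamma>. \<gamma> ` {0..1} \<subseteq> Sh \<and> continuous_on {0..1} \<gamma> \<and> \<gamma> 0 = x \<and> \<gamma> 1 = y}"

lemma segment_path:
  assumes x: "x \<in> Sh" and y: "y \<in> Sh"
  shows "segment_path x y \<in> beam_paths x y"
proof -
  let ?w = "\<lambda>s. (1 - s) *\<^sub>R x + s *\<^sub>R y"
  note xD = ShD[OF x] and yD = ShD[OF y]
  \<comment> \<open>Scaling requires w \<noteq> 0: both endpoints are positive at 1/2, so a convex
    combination cannot cancel.\<close>
  have w_pos: "0 < norm (?w s)" if s: "s \<in> {0..1}" for s
  proof -
    have "0 < app (?w s) (1/2)"
    proof (cases "s = 0")
      case False
      then show ?thesis using app_half_pos[OF x] app_half_pos[OF y] s by (auto intro!: add_nonneg_pos)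
    qed (use app_half_pos[OF x] in simp)
    then have "?w s \<noteq> 0" by (metis app_simps(1) less_irrefl)
    then show ?thesis by simp
  qed
  have "segment_path x y s \<in> Sh" if s: "s \<in> {0..1}" for s
  proof -
    have "norm (?w s) \<le> (1 - s) * norm x + s * norm y"
      using norm_triangle_ineq[of "(1 - s) *\<^sub>R x" "s *\<^sub>R y"] s by simp
    also have "\<dots> \<le> (1 - s) * R1 + s * R1" using s xD yD by (intro add_mono mult_left_mono) auto
    finally have "norm (?w s) \<le> R1" by (simp add: algebra_simps)
    moreover have "norm (segment_path x y s) = max (norm (?w s)) R0"
    proof -
      have "norm (max 1 (R0 / norm w) *\<^sub>R w) = max (norm w) R0" if "0 < norm w" for w :: beam
        unfolding norm_scaleR using that R0_R1 by (simp add: max_def le_divide_eq)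
      from this[OF w_pos[OF s]] show ?thesis by (simp add: segment_path_def Let_def)
    qed
    moreover have "segment_path x y s \<in> bcone"
      unfolding segment_path_def Let_def
      by (intro bcone_scale bcone_lincomb xD yD) (use s in auto)
    ultimately show ?thesis using R0_R1 by (auto simp: Sh_def)
  qed
  moreover have "continuous_on {0..1} (segment_path x y)"
    unfolding segment_path_def Let_def using w_pos by (intro continuous_intros) auto
  moreover have "max 1 (R0 / norm z) = 1" if "z \<in> Sh" for z
  proof -
    have "0 < norm z" using ShD(2)[OF that] R0_R1 by linarith
    then show ?thesis using ShD(2)[OF that] by (intro max_absorb1) (simp add: divide_le_eq)
  qed
  then have "segment_path x y 0 = x" "segment_path x y 1 = y"
    using x y by (simp_all add: segment_path_def)
  ultimately show ?thesis by (auto simp: beam_paths_def)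
qed

section \<open>Translation of paths and extremal levels between the two representations\<close>

lemma app_eq_iff: "app x = app y \<longleftrightarrow> x = y"
  by (metis beam_eqI)

lemma app_in_shell_iff: "app x \<in> shell R0 R1 \<longleftrightarrow> x \<in> Sh"
  by (simp add: shell_def Sh_def bcone_def normX_app)

lemma normX_app_diff: "normX (\<lambda>t. app x t - app y t) = norm (x - y)"
  using normX_app[of "x - y"] by (simp add: minus_beam.rep_eq app.rep_eq)

lemma beam_paths_iff:
  "(\<lambda>t. app (\<gamma> t)) \<in> paths R0 R1 (app x) (app y) \<longleftrightarrow> \<gamma> \<in> beam_paths x y"
  by (simp add: paths_def beam_paths_def app_eq_iff app_in_shell_iff normX_app_diff image_subset_iff
      continuous_on_def tendsto_norm_zero_iff LIM_zero_iff)

text \<open>A path may take arbitrary values off [0,1], where \<open>Abs_beam\<close> says nothing,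
  so agreement is claimed only on [0,1].\<close>

lemma paths_eq:
  assumes "\<delta> \<in> paths R0 R1 (app x) (app y)"
  obtains \<gamma> where "\<gamma> \<in> beam_paths x y" "\<forall>t\<in>{0..1}. app (\<gamma> t) = \<delta> t"
proof -
  define \<gamma> where "\<gamma> t = Abs_beam (\<delta> t)" for t
  have app: "app (\<gamma> t) = \<delta> t" if "t \<in> {0..1}" for t
  proof -
    have "\<delta> t \<in> X" using assms that by (auto simp: paths_def shell_def K_cone_def)
    then show ?thesis by (simp add: \<gamma>_def app.rep_eq Abs_beam_inverse)
  qed
  have "(\<lambda>t. app (\<gamma> t)) \<in> paths R0 R1 (app x) (app y)"
    unfolding paths_def
  proof (intro CollectI conjI ballI)
    fix t :: real assume t: "t \<in> {0..1}"
    show "app (\<gamma> t) \<in> shell R0 R1" using assms t by (simp add: app paths_def)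
    have "((\<lambda>s. normX (\<lambda>x. \<delta> s x - \<delta> t x)) \<longlongrightarrow> 0) (at t within {0..1})"
      using assms t by (simp add: paths_def)
    then show "((\<lambda>s. normX (\<lambda>x. app (\<gamma> s) x - app (\<gamma> t) x)) \<longlongrightarrow> 0) (at t within {0..1})"
    proof (rule Lim_transform_eventually)
      show "\<forall>\<^sub>F s in at t within {0..1}. normX (\<lambda>x. \<delta> s x - \<delta> t x) = normX (\<lambda>x. app (\<gamma> s) x - app (\<gamma> t) x)"
        using t app by (auto simp: eventually_at_filter)
    qed
  qed (use assms app[of 0] app[of 1] in \<open>auto simp: paths_def\<close>)
  then show ?thesis using that app by (simp add: beam_paths_iff)
qed

lemma inf_energy_shell:
  assumes "v \<in> Sh" "\<forall>x\<in>Sh. E v \<le> E x"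
  shows "inf_energy f (shell R0 R1) = ereal (E v)"
proof (rule antisym)
  show "inf_energy f (shell R0 R1) \<le> ereal (E v)"
    unfolding inf_energy_def shell_eq
    using INF_lower[of "app v" "app ` Sh" "\<lambda>u. ereal (energy f u)"] assms(1)
    by (simp add: energy_app ShD)
  show "ereal (E v) \<le> inf_energy f (shell R0 R1)"
    unfolding inf_energy_def shell_eq by (rule INF_greatest) (auto simp: energy_app ShD assms)
qed

lemma minimax_level_eq:
  "minimax_level f R0 R1 (app x) (app y) = (INF \<gamma>\<in>beam_paths x y. SUP t\<in>{0..1}. ereal (E (\<gamma> t)))"
proof (rule antisym)
  have eq: "(SUP t\<in>{0..1}. ereal (energy f (\<delta> t))) = (SUP t\<in>{0..1}. ereal (E (\<gamma> t)))"
    if "\<gamma> \<in> beam_paths x y" "\<forall>t\<in>{0..1}. app (\<gamma> t) = \<delta> t" for \<gamma> \<delta>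
  proof (rule SUP_cong[OF refl])
    fix t :: real assume t: "t \<in> {0..1}"
    then have "\<gamma> t \<in> Sh" using that(1) by (auto simp: beam_paths_def)
    then show "ereal (energy f (\<delta> t)) = ereal (E (\<gamma> t))"
      using that(2) t energy_app[OF ShD(1)] by metis
  qed
  show "minimax_level f R0 R1 (app x) (app y) \<le> (INF \<gamma>\<in>beam_paths x y. SUP t\<in>{0..1}. ereal (E (\<gamma> t)))"
  proof (rule INF_greatest)
    fix \<gamma> assume \<gamma>: "\<gamma> \<in> beam_paths x y"
    then have "(\<lambda>t. app (\<gamma> t)) \<in> paths R0 R1 (app x) (app y)" by (simp add: beam_paths_iff)
    from INF_lower[OF this, of "\<lambda>\<gamma>. SUP t\<in>{0..1}. ereal (energy f (\<gamma> t))"]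
    show "minimax_level f R0 R1 (app x) (app y) \<le> (SUP t\<in>{0..1}. ereal (E (\<gamma> t)))"
      using eq[OF \<gamma>, of "\<lambda>t. app (\<gamma> t)"] by (simp add: minimax_level_def)
  qed
  show "(INF \<gamma>\<in>beam_paths x y. SUP t\<in>{0..1}. ereal (E (\<gamma> t))) \<le> minimax_level f R0 R1 (app x) (app y)"
    unfolding minimax_level_def
  proof (rule INF_greatest)
    fix \<delta> assume "\<delta> \<in> paths R0 R1 (app x) (app y)"
    then obtain \<gamma> where \<gamma>: "\<gamma> \<in> beam_paths x y" "\<forall>t\<in>{0..1}. app (\<gamma> t) = \<delta> t"
      by (rule paths_eq)
    show "(INF \<gamma>\<in>beam_paths x y. SUP t\<in>{0..1}. ereal (E (\<gamma> t))) \<le> (SUP t\<in>{0..1}. ereal (energy f (\<delta> t)))"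
      unfolding eq[OF \<gamma>] by (rule INF_lower[OF \<gamma>(1)])
  qed
qed

lemma path_max:
  assumes "\<gamma> \<in> beam_paths x y"
  obtains t where "t \<in> {0..1}" "(SUP s\<in>{0..1}. ereal (E (\<gamma> s))) = ereal (E (\<gamma> t))"
proof -
  have "continuous_on {0..1} (\<lambda>s. E (\<gamma> s))"
    using assms by (intro continuous_on_compose2[OF continuous_on_E]) (auto simp: beam_paths_def)
  then obtain t where t: "t \<in> {0..1}" "\<And>s. s \<in> {0..1} \<Longrightarrow> E (\<gamma> s) \<le> E (\<gamma> t)"
    using continuous_attains_sup[of "{0..1::real}" "\<lambda>s. E (\<gamma> s)"] by auto
  have "(SUP s\<in>{0..1}. ereal (E (\<gamma> s))) = ereal (E (\<gamma> t))"
  proof (rule antisym)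
    show "(SUP s\<in>{0..1}. ereal (E (\<gamma> s))) \<le> ereal (E (\<gamma> t))"
      by (rule SUP_least) (simp add: t(2))
  qed (rule SUP_upper[OF t(1)])
  from that[OF t(1) this] show ?thesis .
qed

text \<open>
  A path is pushed along \<open>x \<mapsto> x + h (N x - x)\<close>, where the cutoff \<open>h\<close> depends on \<open>E x\<close>, vanishes at the
  endpoints and is \<open>1\<close> at energies near the minimax level \<open>c\<close>. Energies do not increase, so near the
  maximum of an almost optimal path \<open>E (N x)\<close> is still at least \<open>c\<close>, which makes \<open>|x - N x|\<close> small.
\<close>

lemma almost_critical:
  assumes \<gamma>: "\<gamma> \<in> beam_paths x0 x1" and a: "E x0 \<le> a" "E x1 \<le> a" and ac: "a < c"
    and minimax: "\<And>\<delta>. \<delta> \<in> beam_paths x0 x1 \<Longrightarrow> \<exists>t\<in>{0..1}. c \<le> E (\<delta> t)"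
  shows "\<exists>t\<in>{0..1}. c \<le> E (N (\<gamma> t))"
proof -
  \<comment> \<open>The midpoint leaves room for the cutoff h to rise from 0 at energy a to 1 at
    energy b, strictly below c.\<close>
  define b where "b = (a + c) / 2"
  have ab: "a < b" "b < c" using ac by (auto simp: b_def)
  define h where "h x = min 1 (max 0 ((E x - a) / (b - a)))" for x
  define \<eta> where "\<eta> x = (1 - h x) *\<^sub>R x + h x *\<^sub>R N x" for x
  have h01: "0 \<le> h x" "h x \<le> 1" for x by (auto simp: h_def)
  have \<eta>_Sh: "\<eta> x \<in> Sh" if "x \<in> Sh" for x
    unfolding \<eta>_def by (rule segment_Sh[OF that h01])
  have \<eta>_E: "E (\<eta> x) \<le> E x" if "x \<in> Sh" for x
  proof -
    have "(h x)\<^sup>2 \<le> h x" using h01[of x] by (simp add: power2_eq_square mult_left_le)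
    then have "0 \<le> (h x - (h x)\<^sup>2 / 2) * (norm (x - N x))\<^sup>2"
      using h01[of x] by (intro mult_nonneg_nonneg) auto
    then show ?thesis
      using E_descent[OF ShD(1)[OF that] h01[of x]] by (simp add: \<eta>_def)
  qed
  have "continuous_on Sh \<eta>"
    unfolding \<eta>_def h_def using ab by (intro continuous_intros continuous_on_E continuous_on_N) auto
  then have "continuous_on {0..1} (\<lambda>t. \<eta> (\<gamma> t))"
    by (rule continuous_on_compose2) (use \<gamma> in \<open>auto simp: beam_paths_def\<close>)
  \<comment> \<open>Both endpoints have energy at most a, so the deformed path keeps them.\<close>
  moreover have "\<eta> x = x" if "E x \<le> a" for x
  proof -
    have "(E x - a) / (b - a) \<le> 0" using that ab by (simp add: divide_nonpos_pos)
    then show ?thesis by (simp add: \<eta>_def h_def max_def)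
  qed
  ultimately have "(\<lambda>t. \<eta> (\<gamma> t)) \<in> beam_paths x0 x1"
    using \<gamma> a \<eta>_Sh by (auto simp: beam_paths_def)
  from minimax[OF this] obtain t where t: "t \<in> {0..1}" "c \<le> E (\<eta> (\<gamma> t))" by blast
  have "\<gamma> t \<in> Sh" using \<gamma> t by (auto simp: beam_paths_def)
  from \<eta>_E[OF this] have "b < E (\<gamma> t)" using t ab by linarith
  then have "1 \<le> (E (\<gamma> t) - a) / (b - a)" using ab by (simp add: le_divide_eq)
  then have "h (\<gamma> t) = 1" by (simp add: h_def)
  then have "\<eta> (\<gamma> t) = N (\<gamma> t)" by (simp add: \<eta>_def)
  then show ?thesis using t by auto
qed

text \<open>The level is treated as an extended real until it is bounded below by \<open>gap\<close>
  and above by an explicit path. The strict energy inequality is part of the conclusion because it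
  distinguishes v from a minimiser.\<close>

lemma mountain_pass:
  assumes x0: "x0 \<in> Sh" and x1: "x1 \<in> Sh" and r: "norm x0 < r" "r < norm x1"
    and gap: "ereal (max (E x0) (E x1)) < inf_energy f {u \<in> K_cone. normX u = r}"
  obtains v where "v \<in> Sh" "N v = v" "max (E x0) (E x1) < E v"
    "minimax_level f R0 R1 (app x0) (app x1) = ereal (E v)"
proof -
  define a where "a = max (E x0) (E x1)"
  define C where "C = (INF \<gamma>\<in>beam_paths x0 x1. SUP t\<in>{0..1}. ereal (E (\<gamma> t)))"
  have "inf_energy f {u \<in> K_cone. normX u = r} \<le> C"
    unfolding C_def
  proof (rule INF_greatest)
    fix \<gamma> assume \<gamma>: "\<gamma> \<in> beam_paths x0 x1"
    then have "continuous_on {0..1} (\<lambda>t. norm (\<gamma> t))"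
      by (intro continuous_intros) (auto simp: beam_paths_def)
    \<comment> \<open>Every path begins inside and ends outside the sphere of radius r, so it
      crosses that sphere.\<close>
    then obtain t where t: "t \<in> {0..1}" "norm (\<gamma> t) = r"
      using IVT'[of "\<lambda>t. norm (\<gamma> t)" 0 r 1] \<gamma> r by (auto simp: beam_paths_def)
    have "\<gamma> t \<in> Sh" using \<gamma> t(1) by (auto simp: beam_paths_def)
    then have cone: "\<gamma> t \<in> bcone" by (rule ShD)
    then have "app (\<gamma> t) \<in> {u \<in> K_cone. normX u = r}" by (simp add: bcone_def normX_app t)
    then have "inf_energy f {u \<in> K_cone. normX u = r} \<le> ereal (E (\<gamma> t))"
      unfolding inf_energy_def by (rule INF_lower2) (simp add: energy_app[OF cone])
    also have "\<dots> \<le> (SUP t\<in>{0..1}. ereal (E (\<gamma> t)))" by (rule SUP_upper[OF t(1)])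
    finally show "inf_energy f {u \<in> K_cone. normX u = r} \<le> (SUP t\<in>{0..1}. ereal (E (\<gamma> t)))" .
  qed
  with gap have aC: "ereal a < C" unfolding a_def by (rule less_le_trans)
  note seg = segment_path[OF x0 x1]
  obtain t0 where "(SUP s\<in>{0..1}. ereal (E (segment_path x0 x1 s))) = ereal (E (segment_path x0 x1 t0))"
    by (rule path_max[OF seg])
  then have "C \<le> ereal (E (segment_path x0 x1 t0))"
    unfolding C_def using INF_lower[OF seg] by metis
  with aC obtain c where c: "C = ereal c" by (cases C) auto
  have ac: "a < c" using aC c by simp
  have minimax: "\<exists>t\<in>{0..1}. c \<le> E (\<delta> t)" if \<delta>: "\<delta> \<in> beam_paths x0 x1" for \<delta>
  proof -
    obtain t where t: "t \<in> {0..1}" "(SUP s\<in>{0..1}. ereal (E (\<delta> s))) = ereal (E (\<delta> t))"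
      by (rule path_max[OF \<delta>])
    then have "C \<le> ereal (E (\<delta> t))" unfolding C_def using INF_lower[OF \<delta>] by metis
    then show ?thesis using t c by auto
  qed
  have "\<exists>x\<in>Sh. E x < c + inverse (real (Suc n)) \<and> c \<le> E (N x)" for n
  proof -
    have "C < ereal (c + inverse (real (Suc n)))" by (simp add: c)
    then obtain \<gamma> where \<gamma>: "\<gamma> \<in> beam_paths x0 x1"
      and sup: "(SUP t\<in>{0..1}. ereal (E (\<gamma> t))) < ereal (c + inverse (real (Suc n)))"
      unfolding C_def INF_less_iff by blast
    obtain t where t: "t \<in> {0..1}" "c \<le> E (N (\<gamma> t))"
      using almost_critical[OF \<gamma> _ _ ac minimax] by (auto simp: a_def)
    have "ereal (E (\<gamma> t)) \<le> (SUP t\<in>{0..1}. ereal (E (\<gamma> t)))" by (rule SUP_upper[OF t(1)])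
    also note sup
    finally have "E (\<gamma> t) < c + inverse (real (Suc n))" by simp
    moreover have "\<gamma> t \<in> Sh" using \<gamma> t by (auto simp: beam_paths_def)
    ultimately show ?thesis using t by blast
  qed
  then obtain xs where xs: "\<And>n. xs n \<in> Sh" and xs_E: "\<And>n. E (xs n) < c + inverse (real (Suc n))"
    and N_E: "\<And>n. c \<le> E (N (xs n))"
    by metis
  have gap_n: "(norm (xs n - N (xs n)))\<^sup>2 \<le> 2 * (E (xs n) - c)" for n
    using E_N[OF ShD(1)[OF xs], of n] N_E[of n] by simp
  \<comment> \<open>The square on the left of \<open>gap_n\<close> is nonnegative.\<close>
  have xs_c: "c \<le> E (xs n)" for n
    using order_trans[OF zero_le_power2 gap_n[of n]] by simp
  have lim_c: "(\<lambda>n. c + inverse (real (Suc n))) \<longlonglongrightarrow> c"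
    using tendsto_add[OF tendsto_const LIMSEQ_inverse_real_of_nat, of c] by simp
  have E_lim: "(\<lambda>n. E (xs n)) \<longlonglongrightarrow> c"
    by (rule tendsto_sandwich[OF _ _ tendsto_const lim_c])
      (intro always_eventually allI xs_c less_imp_le[OF xs_E])+
  obtain v where v: "v \<in> Sh" "N v = v" "E v = c"
    by (rule Palais_Smale[OF xs tendsto_zero_if_square_le_gap[OF gap_n E_lim] E_lim])
  show ?thesis
    by (rule that[OF v(1,2)]) (use ac c in \<open>simp_all add: v(3) a_def C_def minimax_level_eq\<close>)
qed

end

theorem theorem3p2:
  fixes f :: "real \<Rightarrow> real \<Rightarrow> real" and R0 R1 :: real
  assumes f_cont: "continuous_on ({0..1} \<times> UNIV) (\<lambda>(t, s). f t s)"
    and f_nonneg: "\<And>t s. t \<in> {0..1} \<Longrightarrow> s \<ge> 0 \<Longrightarrow> f t s \<ge> 0"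
    and f_mono_t: "\<And>s. s \<ge> 0 \<Longrightarrow> mono_on {0..1} (\<lambda>t. f t s)"
    and f_mono_s: "\<And>t. t \<in> {0..1} \<Longrightarrow> mono_on {0..} (f t)"
    and R0_R1: "0 < R0" "R0 < R1"
    and lower: "(LBINT t=ereal 0..ereal 1. M0 t * f t (M0 t * R0)) \<ge> R0"
    and upper: "(LBINT t=ereal 0..ereal 1. M1 t * f t (M1 t * R1)) \<le> R1"
  shows "\<exists>um \<in> shell R0 R1.
           positive_solution f um \<and>
           ereal (energy f um) = inf_energy f (shell R0 R1) \<and>
           (\<forall>u0 \<in> shell R0 R1. \<forall>u1 \<in> shell R0 R1. \<forall>r > 0.
              normX u0 < r \<longrightarrow> r < normX u1 \<longrightarrow>
              ereal (max (energy f u0) (energy f u1)) < inf_energy f {u \<in> K_cone. normX u = r} \<longrightarrow>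
              (\<exists>uc \<in> shell R0 R1.
                 positive_solution f uc \<and>
                 ereal (energy f uc) = minimax_level f R0 R1 u0 u1 \<and>
                 uc \<noteq> um))"
proof -
  interpret cantilever f R0 R1
    by unfold_locales (fact assms)+
  obtain v where v: "v \<in> Sh" "N v = v" and v_min: "\<forall>x\<in>Sh. E v \<le> E x"
    by (rule minimiser)
  show ?thesis
  proof (rule bexI[of _ "app v"], intro conjI ballI allI impI)
    show "app v \<in> shell R0 R1" using v by (simp add: shell_eq)
    show "positive_solution f (app v)" by (rule fixed_point_positive[OF v])
    show "ereal (energy f (app v)) = inf_energy f (shell R0 R1)"
      by (simp add: inf_energy_shell[OF v(1) v_min] energy_app[OF ShD(1)[OF v(1)]])
    fix u0 u1 and r :: real
    assume "u0 \<in> shell R0 R1" "u1 \<in> shell R0 R1" and r: "normX u0 < r" "r < normX u1"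
      and gap: "ereal (max (energy f u0) (energy f u1)) < inf_energy f {u \<in> K_cone. normX u = r}"
    then obtain x0 x1 where x: "x0 \<in> Sh" "x1 \<in> Sh" "u0 = app x0" "u1 = app x1"
      by (auto simp: shell_eq)
    have r': "norm x0 < r" "r < norm x1" using r by (simp_all add: x normX_app)
    have gap': "ereal (max (E x0) (E x1)) < inf_energy f {u \<in> K_cone. normX u = r}"
      using gap by (simp add: x energy_app[OF ShD(1)])
    obtain w where w: "w \<in> Sh" "N w = w" "max (E x0) (E x1) < E w"
      "minimax_level f R0 R1 (app x0) (app x1) = ereal (E w)"
      by (rule mountain_pass[OF x(1,2) r' gap'])
    \<comment> \<open>The energy of w exceeds that of x0, which is at least the minimum E v.\<close>
    have "w \<noteq> v" using w(3) v_min x(1) by fastforce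
    then have "app w \<noteq> app v" by (metis beam_eqI)
    then show "\<exists>uc\<in>shell R0 R1. positive_solution f uc \<and>
        ereal (energy f uc) = minimax_level f R0 R1 u0 u1 \<and> uc \<noteq> app v"
      using w fixed_point_positive[OF w(1,2)]
      by (intro bexI[of _ "app w"]) (auto simp: x shell_eq energy_app[OF ShD(1)[OF w(1)]])
  qed
qed

end
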